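(* Let $W$ and $\tilde W$ be weight matrices of size $N_1$ and $N_2$, respectively, supported on the same interval $(x_0,x_1)$. Let $\mathcal{V}=\partial^2F_2(x)+\partial F_1(x)+F_0(x)$ be a differential operator with $F_i\in\mathbb{C}^{N_1\times N_2}[x]$ and $\deg(F_i)\le i$ for $i=0,1,2$. Then $\mathcal{V}$ belongs to the module $\mathcal{D}(W,\tilde W)$ if and only if there exist matrix-valued polynomials $G_i\in\mathbb{C}^{N_2\times N_1}[x]$, $i=0,1,2$, with $\deg(G_i)\le i$, such that $$\begin{aligned}G_2(x)W(x)&=\tilde W(x)F_2(x)^*,\\ G_1(x)W(x)&=2(\tilde W(x)F_2(x)^* )'-\tilde W(x)F_1(x)^*,\\ G_0(x)W(x)&=(\tilde W(x)F_2(x)^* )''-(\tilde W(x)F_1(x)^* )'+\tilde W(x)F_0(x)^*,\end{aligned}$$ with the boundary conditions $$\lim_{x\to x_0,x_1}F_2(x)\tilde W(x)=0,\qquad \lim_{x\to x_0,x_1}\big(F_1(x)\tilde W(x)-W(x)G_1(x)^*\big)=0.$$ Moreover, the differential operator $\mathcal{N}=\partial^2G_2(x)+\partial G_1(x)+G_0(x)$ belongs to the module $\mathcal{D}(\tilde W,W)$.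
   Context: A weight matrix of size $N$ on a possibly infinite interval $(x_0,x_1)$ is a complex $N\times N$ matrix-valued smooth function $W$ on $(x_0,x_1)$ that is positive definite almost everywhere and has finite moments of all orders. For $P,Q\in\operatorname{Mat}_N(\mathbb{C}[x])$ put $\langle P,Q\rangle_W=\int_{x_0}^{x_1}P(x)W(x)Q(x)^*\,dx$, where $*$ is the Hermitian conjugate. A sequence of matrix-valued orthogonal polynomials with respect to $W$ is a sequence $\{P_n\}_{n\in\mathbb{N}_0}$ in $\operatorname{Mat}_N(\mathbb{C}[x])$, $\mathbb{N}_0=\{0,1,\dots\}$, with $P_n$ of degree $n$ with nonsingular leading coefficient and $\langle P_n,P_m\rangle_W=0$ for $n\ne m$. Differential operators $D=\sum_{i=0}^s\partial^iF_i(x)$, $\partial=\frac{d}{dx}$, act on the right: $(P\cdot D)(x)=\sum_{i=0}^s\frac{d^iP}{dx^i}(x)F_i(x)$. $\operatorname{Mat}_{N_1\times N_2}(\Omega[x])$ is the set of such operators whose coefficients $F_i$ are $N_1\times N_2$ matrices with entries in $\mathbb{C}[x]$, and $\operatorname{Mat}_N(\Omega[x])=\operatorname{Mat}_{N\times N}(\Omega[x])$. If $W,\tilde W$ have sizes $N_1,N_2$ and $\{P_n\},\{\tilde P_n\}$ are sequences of matrix-valued orthogonal polynomials with respect to $W,\tilde W$, then $$\mathcal{D}(W,\tilde W)=\{\mathcal{T}\in\operatorname{Mat}_{N_1\times N_2}(\Omega[x]) : \text{for all } n\in\mathbb{N}_0,\ P_n\cdot\mathcal{T}=A_n\tilde P_n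 \text{ for some } A_n\in\operatorname{Mat}_{N_1\times N_2}(\mathbb{C})\}$$ (independent of the chosen orthogonal sequences). For $D=\sum_j\partial^jF_j$ let $D^*=\sum_jF_j(x)^*(-1)^j\partial^j$ be the formal adjoint; thus $Q\cdot(WD^*W^{-1})=\sum_j(-1)^j\frac{d^j}{dx^j}(QWF_j^* )W^{-1}$. Standing assumption on weights: all weight matrices considered (including direct sums $W\oplus\tilde W$ of the weights considered, i.e. block diagonal matrices) are "good enough" in the following sense, written for a weight $W$ of size $N$: if $D\in\operatorname{Mat}_N(\Omega[x])$ and $A\in\operatorname{Mat}_N(\mathbb{C}[x])$ satisfy $\int_{x_0}^{x_1}PAW\,dx=\int_{x_0}^{x_1}P\,(W\cdot D)\,dx$ for all $P\in\operatorname{Mat}_N(\mathbb{C}[x])$, then $AW=W\cdot D$. In particular, whenever $D,\tilde D\in\operatorname{Mat}_N(\Omega[x])$ satisfy $\langle P\cdot D,Q\rangle_W=\langle P,Q\cdot\tilde D\rangle_W$ for all $P,Q\in\operatorname{Mat}_N(\mathbb{C}[x])$, one has $\tilde D=WD^*W^{-1}$. *)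

theory Defs
  imports "HOL-Analysis.Analysis" "HOL-Computational_Algebra.Polynomial"
begin

text \<open>The type \<^typ>\<open>'a^'n^'m\<close> is that of matrices with rows indexed by \<open>'m\<close> and columns
  indexed by \<open>'n\<close>; an \<open>N\<^sub>1 \<times> N\<^sub>2\<close> matrix therefore has type \<open>'a^'n2^'n1\<close>.\<close>

definition hermitian_conj :: "complex^'n^'m \<Rightarrow> complex^'m^'n" where
  "hermitian_conj A = (\<chi> i j. cnj (A $ j $ i))"

definition positive_definite :: "complex^'n^'n \<Rightarrow> bool" where
  "positive_definite A \<longleftrightarrow>
     hermitian_conj A = A \<and>
     (\<forall>v::complex^'n. v \<noteq> 0 \<longrightarrow> 0 < Re (\<Sum>i\<in>UNIV. \<Sum>j\<in>UNIV. cnj (v $ i) * A $ i $ j * v $ j))"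

definition direct_sum :: "complex^'n^'n \<Rightarrow> complex^'m^'m \<Rightarrow> complex^('n + 'm)^('n + 'm)" where
  "direct_sum A B = (\<chi> i j. case i of
      Inl k \<Rightarrow> (case j of Inl l \<Rightarrow> A $ k $ l | Inr l \<Rightarrow> 0)
    | Inr k \<Rightarrow> (case j of Inl l \<Rightarrow> 0 | Inr l \<Rightarrow> B $ k $ l))"

definition eval_mat :: "complex poly^'n^'m \<Rightarrow> real \<Rightarrow> complex^'n^'m" where
  "eval_mat F x = (\<chi> i j. poly (F $ i $ j) (of_real x))"

definition const_mat :: "complex^'n^'m \<Rightarrow> complex poly^'n^'m" where
  "const_mat A = (\<chi> i j. [:A $ i $ j:])"

definition coeff_mat :: "complex poly^'n^'m \<Rightarrow> nat \<Rightarrow> complex^'n^'m" where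
  "coeff_mat F k = (\<chi> i j. coeff (F $ i $ j) k)"

definition pderiv_mat :: "complex poly^'n^'m \<Rightarrow> complex poly^'n^'m" where
  "pderiv_mat F = (\<chi> i j. pderiv (F $ i $ j))"

definition mat_degree_le :: "complex poly^'n^'m \<Rightarrow> nat \<Rightarrow> bool" where
  "mat_degree_le F k \<longleftrightarrow> (\<forall>i j. degree (F $ i $ j) \<le> k)"

definition nth_deriv :: "nat \<Rightarrow> (real \<Rightarrow> 'a::real_normed_vector) \<Rightarrow> real \<Rightarrow> 'a" where
  "nth_deriv k f = ((\<lambda>g t. vector_derivative g (at t)) ^^ k) f"

definition weight_matrix :: "ereal \<Rightarrow> ereal \<Rightarrow> (real \<Rightarrow> complex^'n^'n) \<Rightarrow> bool" where
  "weight_matrix x0 x1 W \<longleftrightarrow>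
     (\<forall>k. \<forall>x\<in>einterval x0 x1. nth_deriv k W differentiable (at x)) \<and>
     (AE x in lborel. x \<in> einterval x0 x1 \<longrightarrow> positive_definite (W x)) \<and>
     (\<forall>k::nat. interval_lebesgue_integrable lborel x0 x1 (\<lambda>x. x ^ k *\<^sub>R W x))"

definition weight_inner :: "ereal \<Rightarrow> ereal \<Rightarrow> (real \<Rightarrow> complex^'n^'n) \<Rightarrow>
    complex poly^'n^'m \<Rightarrow> complex poly^'n^'k \<Rightarrow> complex^'k^'m" where
  "weight_inner x0 x1 W P Q =
     (LBINT x=x0..x1. eval_mat P x ** W x ** hermitian_conj (eval_mat Q x))"

definition orthogonal_polys :: "ereal \<Rightarrow> ereal \<Rightarrow> (real \<Rightarrow> complex^'n^'n) \<Rightarrow>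
    (nat \<Rightarrow> complex poly^'n^'n) \<Rightarrow> bool" where
  "orthogonal_polys x0 x1 W P \<longleftrightarrow>
     (\<forall>n. mat_degree_le (P n) n \<and> invertible (coeff_mat (P n) n)) \<and>
     (\<forall>n m. n \<noteq> m \<longrightarrow> weight_inner x0 x1 W (P n) (P m) = 0)"

text \<open>The operator \<open>\<Sum>\<^sub>i \<partial>\<^sup>i F\<^sub>i(x)\<close> is encoded as the polynomial in \<open>\<partial>\<close> whose \<open>i\<close>-th coefficient
  is the matrix polynomial \<open>F\<^sub>i\<close>. Only the coefficients of this polynomial are meaningful; the
  multiplication of the type \<open>poly\<close> is not composition of operators.\<close>

type_synonym ('n1, 'n2) diff_op = "(complex poly^'n2^'n1) poly"

definition op_poly :: "complex poly^'n1^'k \<Rightarrow> ('n1, 'n2) diff_op \<Rightarrow> complex poly^'n2^'k" where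
  "op_poly P D = (\<Sum>i\<le>degree D. (pderiv_mat ^^ i) P ** coeff D i)"

definition op_fun :: "(real \<Rightarrow> complex^'n1^'k) \<Rightarrow> ('n1, 'n2) diff_op \<Rightarrow> real \<Rightarrow> complex^'n2^'k" where
  "op_fun f D x = (\<Sum>i\<le>degree D. nth_deriv i f x ** eval_mat (coeff D i) x)"

text \<open>The module \<open>\<D>(W, Wt)\<close> does not depend on the orthogonal sequences used to define it.\<close>

definition op_module :: "ereal \<Rightarrow> ereal \<Rightarrow> (real \<Rightarrow> complex^'n1^'n1) \<Rightarrow> (real \<Rightarrow> complex^'n2^'n2) \<Rightarrow>
    ('n1, 'n2) diff_op set" where
  "op_module x0 x1 W Wt = {T. \<exists>P Pt.
     orthogonal_polys x0 x1 W P \<and> orthogonal_polys x0 x1 Wt Pt \<and>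
     (\<forall>n. \<exists>A :: complex^'n2^'n1. op_poly (P n) T = const_mat A ** Pt n)}"

text \<open>\<open>Q \<cdot> (W D\<^sup>* W\<^sup>-\<^sup>1) = \<Sum>\<^sub>j (-1)\<^sup>j (d/dx)\<^sup>j (Q W F\<^sub>j\<^sup>*) W\<^sup>-\<^sup>1\<close> for the operator \<open>D = \<Sum>\<^sub>j \<partial>\<^sup>j F\<^sub>j\<close>;
  meaningful at the points where \<open>W\<close> is nonsingular.\<close>

definition adjoint_action :: "(real \<Rightarrow> complex^'n^'n) \<Rightarrow> ('n, 'n) diff_op \<Rightarrow>
    complex poly^'n^'n \<Rightarrow> real \<Rightarrow> complex^'n^'n" where
  "adjoint_action W D Q x =
     (\<Sum>j\<le>degree D. (- 1) ^ j *\<^sub>R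
        nth_deriv j (\<lambda>t. eval_mat Q t ** W t ** hermitian_conj (eval_mat (coeff D j) t)) x)
     ** matrix_inv (W x)"

text \<open>Both parts of the standing assumption on weights. Equality of integrals in the first part
  includes their existence; the integral of \<open>P A W\<close> exists because the moments do. The second
  part says that an operator adjoint to \<open>D\<close> is the formal adjoint \<open>W D\<^sup>* W\<^sup>-\<^sup>1\<close>.\<close>

definition good_enough :: "ereal \<Rightarrow> ereal \<Rightarrow> (real \<Rightarrow> complex^'n^'n) \<Rightarrow> bool" where
  "good_enough x0 x1 W \<longleftrightarrow>
     (\<forall>(D :: ('n, 'n) diff_op) (A :: complex poly^'n^'n).
        (\<forall>P :: complex poly^'n^'n.
           interval_lebesgue_integrable lborel x0 x1 (\<lambda>x. eval_mat P x ** op_fun W D x) \<and>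
           (LBINT x=x0..x1. eval_mat P x ** eval_mat A x ** W x) =
           (LBINT x=x0..x1. eval_mat P x ** op_fun W D x)) \<longrightarrow>
        (\<forall>x\<in>einterval x0 x1. eval_mat A x ** W x = op_fun W D x)) \<and>
     (\<forall>(D :: ('n, 'n) diff_op) (D' :: ('n, 'n) diff_op).
        (\<forall>(P :: complex poly^'n^'n) (Q :: complex poly^'n^'n).
           weight_inner x0 x1 W (op_poly P D) Q = weight_inner x0 x1 W P (op_poly Q D')) \<longrightarrow>
        (\<forall>Q :: complex poly^'n^'n. \<forall>x\<in>einterval x0 x1. invertible (W x) \<longrightarrow>
           eval_mat (op_poly Q D') x = adjoint_action W D Q x))"

definition symmetry_equations :: "ereal \<Rightarrow> ereal \<Rightarrow>
    (real \<Rightarrow> complex^'n1^'n1) \<Rightarrow> (real \<Rightarrow> complex^'n2^'n2) \<Rightarrow>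
    complex poly^'n2^'n1 \<Rightarrow> complex poly^'n2^'n1 \<Rightarrow> complex poly^'n2^'n1 \<Rightarrow>
    complex poly^'n1^'n2 \<Rightarrow> complex poly^'n1^'n2 \<Rightarrow> complex poly^'n1^'n2 \<Rightarrow> bool" where
  "symmetry_equations x0 x1 W Wt F0 F1 F2 G0 G1 G2 \<longleftrightarrow>
     (let WF = (\<lambda>F t. Wt t ** hermitian_conj (eval_mat F t)) in
      \<forall>x\<in>einterval x0 x1.
        eval_mat G2 x ** W x = WF F2 x \<and>
        eval_mat G1 x ** W x = 2 *\<^sub>R nth_deriv 1 (WF F2) x - WF F1 x \<and>
        eval_mat G0 x ** W x = nth_deriv 2 (WF F2) x - nth_deriv 1 (WF F1) x + WF F0 x)"

text \<open>One-sided limits are taken in \<^typ>\<open>ereal\<close>, so that infinite endpoints are covered.\<close>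

definition boundary_conditions :: "ereal \<Rightarrow> ereal \<Rightarrow>
    (real \<Rightarrow> complex^'n1^'n1) \<Rightarrow> (real \<Rightarrow> complex^'n2^'n2) \<Rightarrow>
    complex poly^'n2^'n1 \<Rightarrow> complex poly^'n2^'n1 \<Rightarrow> complex poly^'n1^'n2 \<Rightarrow> bool" where
  "boundary_conditions x0 x1 W Wt F1 F2 G1 \<longleftrightarrow>
     (let B2 = (\<lambda>x. eval_mat F2 x ** Wt x);
          B1 = (\<lambda>x. eval_mat F1 x ** Wt x - W x ** hermitian_conj (eval_mat G1 x)) in
      ((B2 \<circ> real_of_ereal) \<longlongrightarrow> 0) (at_right x0) \<and>
      ((B2 \<circ> real_of_ereal) \<longlongrightarrow> 0) (at_left x1) \<and>
      ((B1 \<circ> real_of_ereal) \<longlongrightarrow> 0) (at_right x0) \<and>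
      ((B1 \<circ> real_of_ereal) \<longlongrightarrow> 0) (at_left x1))"

end

theory Submission
  imports Defs
begin

text \<open>The key fact is an equivalence with adjointness: \<open>V\<close> lies in \<open>\<D>(W, Wt)\<close> iff there is an operator
  \<open>N\<close> of order two with \<open>\<langle>P \<cdot> V, Q\<rangle> = \<langle>P, Q \<cdot> N\<rangle>\<close> for all matrix polynomials, neither operator raising
  degrees. If \<open>V\<close> is in the module, expanding in the orthogonal polynomials gives an adjoint linear
  map; multiplication by \<open>x\<close> is symmetric, so the third commutator of this map with \<open>x\<close> vanishes and
  the map is a differential operator of order two. Conversely, an adjoint makes \<open>P\<^sub>n \<cdot> V\<close> orthogonal to
  all polynomials of degree less than \<open>n\<close>; the roles of \<open>V\<close> and \<open>N\<close> are symmetric.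

  For adjoint operators the assumption on \<open>W \<oplus> Wt\<close>, applied to the block operators with
  off-diagonal entries \<open>V\<close> and \<open>N\<close>, gives the symmetry equations. Under these,
  \<open>(P \<cdot> V) Wt Q\<^sup>* - P W (Q \<cdot> N)\<^sup>*\<close> is the derivative of the boundary form
  \<open>P' M\<^sub>2 Q\<^sup>* - P M\<^sub>2 Q'\<^sup>* + (1/2) P M\<^sub>1 Q\<^sup>*\<close> with \<open>M\<^sub>2 = F\<^sub>2 Wt\<close> and \<open>M\<^sub>1 = F\<^sub>1 Wt - W G\<^sub>1\<^sup>*\<close>.
  The derivatives of \<open>M\<^sub>2\<close> and \<open>M\<^sub>1\<close> have finite moments, so the boundary form has limits at both end
  points, which are zero at infinite ones; adjointness means that the two limits agree for all
  \<open>P\<close> and \<open>Q\<close>, and this is equivalent to the boundary conditions.\<close>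

subsection \<open>Complex matrices\<close>

lemma matrix_add_rdistrib: "(A + B) ** C = A ** C + B ** C"
  for A B :: "'a::semiring_1^'n^'m"
  by (simp add: matrix_matrix_mult_def vec_eq_iff distrib_right sum.distrib)

lemma matrix_diff_ldistrib: "A ** (B - C) = A ** B - A ** C"
  for A :: "'a::ring_1^'n^'m"
  by (simp add: matrix_matrix_mult_def vec_eq_iff right_diff_distrib sum_subtractf)

lemma matrix_diff_rdistrib: "(A - B) ** C = A ** C - B ** C"
  for A B :: "'a::ring_1^'n^'m"
  by (simp add: matrix_matrix_mult_def vec_eq_iff left_diff_distrib sum_subtractf)

lemma matrix_scaleR_left: "(k *\<^sub>R A) ** B = k *\<^sub>R (A ** B)"
  for A :: "complex^'n^'m"
  by (simp add: matrix_matrix_mult_def vec_eq_iff scaleR_sum_right)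

lemma matrix_scaleR_right: "A ** (k *\<^sub>R B) = k *\<^sub>R (A ** B)"
  for A :: "complex^'n^'m"
  by (simp add: matrix_matrix_mult_def vec_eq_iff scaleR_sum_right)

lemmas matrix_distribs = matrix_add_ldistrib matrix_add_rdistrib matrix_diff_ldistrib
  matrix_diff_rdistrib matrix_scaleR_left matrix_scaleR_right

lemma bounded_bilinear_matrix_mult:
  "bounded_bilinear ((**) :: complex^'n^'m \<Rightarrow> complex^'p^'n \<Rightarrow> complex^'p^'m)"
  unfolding bilinear_conv_bounded_bilinear[symmetric] bilinear_def
  by (auto intro!: linearI simp: matrix_distribs)

lemmas bounded_linear_matrix_mult_left = bounded_bilinear.bounded_linear_left[OF bounded_bilinear_matrix_mult]
lemmas bounded_linear_matrix_mult_right = bounded_bilinear.bounded_linear_right[OF bounded_bilinear_matrix_mult]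
lemmas continuous_on_matrix_mult [continuous_intros] =
  bounded_bilinear.continuous_on[OF bounded_bilinear_matrix_mult]
lemmas tendsto_matrix_mult [tendsto_intros] =
  bounded_bilinear.tendsto[OF bounded_bilinear_matrix_mult]
lemmas has_vector_derivative_matrix_mult =
  bounded_bilinear.has_vector_derivative[OF bounded_bilinear_matrix_mult]

text \<open>Take for \<open>K\<close> a matrix all of whose rows are the \<open>i\<close>-th unit
  row: each row of \<open>K ** A\<close> is then row \<open>i\<close> of \<open>A\<close>.\<close>

lemma matrix_eq_0_left: "A = 0" if "\<And>K :: complex^'m^'k. K ** A = 0" for A :: "complex^'n^'m"
proof -
  { fix i j
    define K :: "complex^'m^'k" where "K = (\<chi> a b. if b = i then 1 else 0)"
    have "(K ** A) $ undefined $ j = A $ i $ j"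
      by (simp add: K_def matrix_matrix_mult_def if_distrib[of "\<lambda>z. z * _"] cong: if_cong)
    then have "A $ i $ j = 0" using that[of K] by simp }
  then show ?thesis by (simp add: vec_eq_iff)
qed

lemma invertible_0_left: "A = 0" if "A ** H = 0" "invertible H" for A :: "complex^'n^'m"
proof -
  obtain H' where "H ** H' = mat 1" using \<open>invertible H\<close> by (auto simp: invertible_def)
  then have "A = (A ** H) ** H'" by (simp add: matrix_mul_assoc[symmetric])
  then show ?thesis using that by simp
qed

lemma invertible_0_right: "A = 0" if "H ** A = 0" "invertible H" for A :: "complex^'n^'m"
proof -
  obtain H' where "H' ** H = mat 1" using \<open>invertible H\<close> by (auto simp: invertible_def)
  then have "A = H' ** (H ** A)" by (simp add: matrix_mul_assoc)
  then show ?thesis using that by simp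
qed

lemma matrix_inv_left: "matrix_inv H ** H = mat 1" if "invertible H" for H :: "complex^'n^'n"
  using someI_ex[OF that[unfolded invertible_def]] unfolding matrix_inv_def by blast

lemma matrix_inv_right: "H ** matrix_inv H = mat 1" if "invertible H" for H :: "complex^'n^'n"
  using someI_ex[OF that[unfolded invertible_def]] unfolding matrix_inv_def by blast

lemma invertible_mat: "invertible (mat c :: complex^'n^'n)" if "c \<noteq> 0"
  using that unfolding invertible_def
  by (intro exI[of _ "mat (1/c)"]) (simp add: matrix_matrix_mult_def mat_def vec_eq_iff
      if_distrib[of "\<lambda>z. z * _"] if_distrib[of "\<lambda>z. _ * z"] cong: if_cong)

lemma hermitian_conj_nth [simp]: "hermitian_conj A $ i $ j = cnj (A $ j $ i)"
  by (simp add: hermitian_conj_def)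

lemma hermitian_conj_hermitian_conj [simp]: "hermitian_conj (hermitian_conj A) = A"
  by (simp add: vec_eq_iff)

lemma hermitian_conj_mult: "hermitian_conj (A ** B) = hermitian_conj B ** hermitian_conj A"
  by (simp add: vec_eq_iff matrix_matrix_mult_def cnj_sum mult.commute)

lemma bounded_linear_hermitian_conj: "bounded_linear (hermitian_conj :: complex^'n^'m \<Rightarrow> _)"
  by (intro linear_conv_bounded_linear[THEN iffD1] linearI) (simp_all add: vec_eq_iff)

lemma hermitian_conj_0 [simp]: "hermitian_conj 0 = 0"
  and hermitian_conj_mat_1 [simp]: "hermitian_conj (mat 1) = mat 1"
  and hermitian_conj_add: "hermitian_conj (A + B) = hermitian_conj A + hermitian_conj B"
  and hermitian_conj_diff: "hermitian_conj (A - B) = hermitian_conj A - hermitian_conj B"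
  and hermitian_conj_scaleR: "hermitian_conj (c *\<^sub>R A) = c *\<^sub>R hermitian_conj A"
  by (simp_all add: vec_eq_iff mat_def)

lemmas continuous_on_hermitian_conj [continuous_intros] =
  bounded_linear.continuous_on[OF bounded_linear_hermitian_conj]
lemmas tendsto_hermitian_conj [tendsto_intros] =
  bounded_linear.tendsto[OF bounded_linear_hermitian_conj]
lemmas has_vector_derivative_hermitian_conj =
  bounded_linear.has_vector_derivative[OF bounded_linear_hermitian_conj]

subsection \<open>Matrix polynomials\<close>

text \<open>Multiplication by the variable \<open>x\<close> as a scalar; the monomial
  \<open>x^k I\<close> is \<open>(mat_shift ^^ k) (mat 1)\<close>.\<close>

definition mat_shift :: "complex poly^'n^'m \<Rightarrow> complex poly^'n^'m" where
  "mat_shift P = (\<chi> i j. pCons 0 (P $ i $ j))"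

lemma eval_mat_0 [simp]: "eval_mat 0 x = 0"
  and eval_mat_1 [simp]: "eval_mat (mat 1) x = mat 1"
  and eval_mat_mat: "eval_mat (mat p) x = mat (poly p (of_real x))"
  and eval_mat_add: "eval_mat (P + Q) x = eval_mat P x + eval_mat Q x"
  and eval_mat_diff: "eval_mat (P - Q) x = eval_mat P x - eval_mat Q x"
  and eval_mat_const [simp]: "eval_mat (const_mat A) x = A"
  and eval_mat_shift: "eval_mat (mat_shift P) x = x *\<^sub>R eval_mat P x"
  by (auto simp: eval_mat_def vec_eq_iff mat_def const_mat_def mat_shift_def scaleR_conv_of_real[where 'a=complex])

lemma eval_mat_mult: "eval_mat (P ** Q) x = eval_mat P x ** eval_mat Q x"
  by (simp add: eval_mat_def vec_eq_iff matrix_matrix_mult_def poly_sum)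

lemma eval_mat_funpow_shift: "eval_mat ((mat_shift ^^ k) P) x = x ^ k *\<^sub>R eval_mat P x"
  by (induction k) (simp_all add: eval_mat_shift)

lemma pderiv_mat_add: "pderiv_mat (P + Q) = pderiv_mat P + pderiv_mat Q"
  and pderiv_mat_0 [simp]: "pderiv_mat 0 = 0"
  and pderiv_mat_1 [simp]: "pderiv_mat (mat 1) = 0"
  and pderiv_mat_mat: "pderiv_mat (mat p) = mat (pderiv p)"
  and pderiv_mat_shift: "pderiv_mat (mat_shift P) = P + mat_shift (pderiv_mat P)"
  by (auto simp: pderiv_mat_def vec_eq_iff mat_def mat_shift_def pderiv_add pderiv_diff pderiv_pCons)

lemma pderiv_sum: "pderiv (sum f S) = (\<Sum>i\<in>S. pderiv (f i))"
  by (induction S rule: infinite_finite_induct) (simp_all add: pderiv_add)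

lemma pderiv_mat_const_mult: "pderiv_mat (const_mat A ** P) = const_mat A ** pderiv_mat P"
  by (simp add: pderiv_mat_def vec_eq_iff const_mat_def matrix_matrix_mult_def pderiv_smult pderiv_sum)

lemma const_mat_0 [simp]: "const_mat 0 = 0"
  by (simp add: const_mat_def vec_eq_iff)

lemma mat_shift_nth: "mat_shift P $ i $ j = [:0, 1:] * P $ i $ j"
  by (simp add: mat_shift_def)

lemma mat_shift_0 [simp]: "mat_shift 0 = 0"
  and mat_shift_add: "mat_shift (P + Q) = mat_shift P + mat_shift Q"
  by (simp_all add: vec_eq_iff mat_shift_nth algebra_simps)

lemma mat_shift_mult_left: "mat_shift P ** Q = mat_shift (P ** Q)"
  and mat_shift_mult_right: "P ** mat_shift Q = mat_shift (P ** Q)"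
  by (simp_all add: vec_eq_iff mat_shift_nth matrix_matrix_mult_def sum_distrib_left mult_ac)

section \<open>Degrees and leading coefficients of matrix polynomials\<close>

lemma coeff_mat_add: "coeff_mat (P + Q) k = coeff_mat P k + coeff_mat Q k"
  and coeff_mat_diff: "coeff_mat (P - Q) k = coeff_mat P k - coeff_mat Q k"
  and coeff_mat_0 [simp]: "coeff_mat 0 k = 0"
  by (simp_all add: coeff_mat_def vec_eq_iff)

lemma coeff_mat_const_mult: "coeff_mat (const_mat A ** P) k = A ** coeff_mat P k"
  by (simp add: coeff_mat_def const_mat_def vec_eq_iff matrix_matrix_mult_def coeff_sum)

lemma coeff_mat_shift: "coeff_mat (mat_shift P) k = (if k = 0 then 0 else coeff_mat P (k - 1))"
  by (simp add: coeff_mat_def mat_shift_def vec_eq_iff coeff_pCons split: nat.split)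

lemma coeff_mat_funpow_shift_1: "coeff_mat ((mat_shift ^^ n) (mat 1)) k = (if k = n then mat 1 else 0)"
proof (induction n arbitrary: k)
  case 0
  then show ?case by (simp add: coeff_mat_def mat_def vec_eq_iff)
next
  case (Suc n)
  then show ?case by (auto simp: coeff_mat_shift)
qed

text \<open>A strict bound read off from the coefficients, so that the bound 0 singles out the zero
  polynomial and inductions on the degree can start there.\<close>

definition mat_degree_less :: "complex poly^'n^'m \<Rightarrow> nat \<Rightarrow> bool" where
  "mat_degree_less P n \<longleftrightarrow> (\<forall>k\<ge>n. coeff_mat P k = 0)"

lemma mat_degree_le_iff_less: "mat_degree_le P n \<longleftrightarrow> mat_degree_less P (Suc n)"
proof -
  have "degree p \<le> n \<longleftrightarrow> (\<forall>k\<ge>Suc n. coeff p k = 0)" for p :: "complex poly"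
    using degree_le[of n p] by (auto intro!: coeff_eq_0 simp: Suc_le_eq)
  then show ?thesis
    by (auto simp: mat_degree_le_def mat_degree_less_def coeff_mat_def vec_eq_iff)
qed

lemma mat_degree_less_0_iff [simp]: "mat_degree_less P 0 \<longleftrightarrow> P = 0"
  by (auto simp: mat_degree_less_def coeff_mat_def vec_eq_iff poly_eq_iff)

lemma mat_degree_less_add: "mat_degree_less P n \<Longrightarrow> mat_degree_less Q n \<Longrightarrow> mat_degree_less (P + Q) n"
  and mat_degree_less_diff: "mat_degree_less P n \<Longrightarrow> mat_degree_less Q n \<Longrightarrow> mat_degree_less (P - Q) n"
  and mat_degree_less_const_mult: "mat_degree_less P n \<Longrightarrow> mat_degree_less (const_mat A ** P) n"
  and mat_degree_less_shift: "mat_degree_less P n \<Longrightarrow> mat_degree_less (mat_shift P) (Suc n)"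
  and mat_degree_less_mono: "mat_degree_less P n \<Longrightarrow> n \<le> m \<Longrightarrow> mat_degree_less P m"
  by (auto simp: mat_degree_less_def coeff_mat_add coeff_mat_diff coeff_mat_const_mult coeff_mat_shift)

lemma mat_degree_less_SucD:
  "mat_degree_less P n" if "mat_degree_less P (Suc n)" "coeff_mat P n = 0"
  using that unfolding mat_degree_less_def by (metis le_less Suc_le_eq)

lemma mat_degree_less_ex: "\<exists>n. mat_degree_less P n" for P :: "complex poly^'n^'m"
proof -
  define d where "d = (\<Sum>i\<in>UNIV. \<Sum>j\<in>UNIV. degree (P $ i $ j))"
  have "degree (P $ i $ j) \<le> d" for i j
  proof -
    have "degree (P $ i $ j) \<le> (\<Sum>j\<in>UNIV. degree (P $ i $ j))"
      by (rule member_le_sum) auto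
    also have "\<dots> \<le> d"
      unfolding d_def by (rule member_le_sum[of i UNIV "\<lambda>i. \<Sum>j\<in>UNIV. degree (P $ i $ j)"]) auto
    finally show ?thesis .
  qed
  then have "mat_degree_le P d" by (simp add: mat_degree_le_def)
  then show ?thesis unfolding mat_degree_le_iff_less ..
qed

text \<open>The invertible leading coefficient of \<open>P\<close> lets a constant multiple of
  \<open>P\<close> cancel the top coefficient of \<open>Q\<close>. Repetition expands
  \<open>Q\<close> in any sequence with nonsingular leading coefficients.\<close>

lemma mat_degree_less_split:
  fixes P :: "complex poly^'n^'n"
  assumes "mat_degree_less Q (Suc n)" "mat_degree_less P (Suc n)" "invertible (coeff_mat P n)"
  obtains A Q' where "Q = const_mat A ** P + Q'" "mat_degree_less Q' n"
proof
  define A where "A = coeff_mat Q n ** matrix_inv (coeff_mat P n)"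
  show "Q = const_mat A ** P + (Q - const_mat A ** P)" by simp
  have "coeff_mat (Q - const_mat A ** P) n = 0"
    using assms(3) by (simp add: A_def coeff_mat_diff coeff_mat_const_mult
        matrix_inv_left flip: matrix_mul_assoc)
  moreover have "mat_degree_less (Q - const_mat A ** P) (Suc n)"
    by (rule mat_degree_less_diff[OF assms(1) mat_degree_less_const_mult[OF assms(2)]])
  ultimately show "mat_degree_less (Q - const_mat A ** P) n"
    by (rule mat_degree_less_SucD[rotated])
qed

text \<open>Splitting off the top coefficient against the monomial of that degree ends, after
  finitely many rounds, at the zero polynomial.\<close>

lemma mat_poly_induct [case_names zero const_mult add]:
  fixes P :: "complex poly^'n^'m"
  assumes "\<Phi> 0" "\<And>A k. \<Phi> (const_mat A ** (mat_shift ^^ k) (mat 1))"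
    "\<And>P Q. \<Phi> P \<Longrightarrow> \<Phi> Q \<Longrightarrow> \<Phi> (P + Q)"
  shows "\<Phi> P"
proof -
  have "mat_degree_less P n \<Longrightarrow> \<Phi> P" for n
  proof (induction n arbitrary: P)
    case 0
    then show ?case using assms(1) by simp
  next
    case (Suc n)
    have "mat_degree_less ((mat_shift ^^ n) (mat 1 :: complex poly^'n^'n)) (Suc n)"
      "invertible (coeff_mat ((mat_shift ^^ n) (mat 1 :: complex poly^'n^'n)) n)"
      by (auto simp: mat_degree_less_def coeff_mat_funpow_shift_1 invertible_mat)
    from mat_degree_less_split[OF Suc.prems this] obtain A Q' where
      "P = const_mat A ** (mat_shift ^^ n) (mat 1) + Q'" "mat_degree_less Q' n" .
    then show ?case using assms Suc.IH by metis
  qed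
  then show ?thesis using mat_degree_less_ex by blast
qed

lemma has_vector_derivative_eval_mat:
  "(eval_mat P has_vector_derivative eval_mat (pderiv_mat P) x) (at x within S)"
proof (induction P rule: mat_poly_induct)
  case zero
  then show ?case by (simp add: eval_mat_0[abs_def])
next
  case (const_mult A k)
  have "(eval_mat ((mat_shift ^^ k) (mat 1)) has_vector_derivative
      eval_mat (pderiv_mat ((mat_shift ^^ k) (mat 1))) x) (at x within S)"
  proof (induction k)
    case 0
    then show ?case by (simp add: eval_mat_mat[abs_def] eval_mat_1[abs_def])
  next
    case (Suc k)
    from has_vector_derivative_scaleR[OF DERIV_ident this]
    show ?case
      by (simp add: pderiv_mat_shift eval_mat_add eval_mat_shift[abs_def] eval_mat_shift add.commute)
  qed
  from bounded_linear.has_vector_derivative[OF bounded_linear_matrix_mult_right this]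
  show ?case by (simp add: eval_mat_mult[abs_def] pderiv_mat_const_mult eval_mat_mult)
next
  case (add P Q)
  then show ?case
    by (simp add: eval_mat_add[abs_def] pderiv_mat_add eval_mat_add has_vector_derivative_add)
qed

lemma continuous_on_eval_mat [continuous_intros]: "continuous_on S (eval_mat P)"
  by (rule continuous_on_vector_derivative) (rule has_vector_derivative_eval_mat)

section \<open>Operators of order two acting on matrix polynomials\<close>

lemma op_poly_quadratic:
  "op_poly P [:F0, F1, F2:] = P ** F0 + pderiv_mat P ** F1 + pderiv_mat (pderiv_mat P) ** F2"
proof -
  let ?D = "[:F0, F1, F2:]"
  have "op_poly P ?D = (\<Sum>i\<le>2. (pderiv_mat ^^ i) P ** coeff ?D i)"
    unfolding op_poly_def
    \<comment> \<open>The encoding drops zero leading coefficients, so the degree may be below two;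
      the terms added by summing up to two vanish.\<close>
    by (rule sum.mono_neutral_left) (auto simp: coeff_eq_0 degree_pCons_eq_if numeral_2_eq_2)
  then show ?thesis by (simp add: numeral_2_eq_2)
qed

lemma op_poly_quadratic_add:
  "op_poly (P + Q) [:F0, F1, F2:] = op_poly P [:F0, F1, F2:] + op_poly Q [:F0, F1, F2:]"
  by (simp add: op_poly_quadratic pderiv_mat_add matrix_add_rdistrib)

lemma op_poly_quadratic_0 [simp]: "op_poly 0 [:F0, F1, F2:] = 0"
  by (simp add: op_poly_quadratic)

lemma op_poly_quadratic_const_mult:
  "op_poly (const_mat A ** P) [:F0, F1, F2:] = const_mat A ** op_poly P [:F0, F1, F2:]"
  by (simp add: op_poly_quadratic pderiv_mat_const_mult matrix_add_ldistrib matrix_mul_assoc)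

text \<open>The vanishing of the third commutator with multiplication by \<open>x\<close>, rearranged so that no
  subtraction occurs.\<close>

lemma op_poly_quadratic_shift3:
  fixes F0 F1 F2 :: "complex poly^'n^'m"
  defines "V \<equiv> [:F0, F1, F2:]"
  shows "op_poly (mat_shift (mat_shift (mat_shift P))) V
      + (mat_shift (mat_shift (op_poly (mat_shift P) V))
        + mat_shift (mat_shift (op_poly (mat_shift P) V))
        + mat_shift (mat_shift (op_poly (mat_shift P) V)))
    = (mat_shift (op_poly (mat_shift (mat_shift P)) V)
        + mat_shift (op_poly (mat_shift (mat_shift P)) V)
        + mat_shift (op_poly (mat_shift (mat_shift P)) V))
      + mat_shift (mat_shift (mat_shift (op_poly P V)))"
  by (simp only: V_def op_poly_quadratic pderiv_mat_shift pderiv_mat_add mat_shift_add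
      mat_shift_mult_left matrix_add_rdistrib add_ac)

text \<open>A nonzero \<open>i\<close>-th derivative has lost \<open>i\<close> degrees, and the
  \<open>i\<close>-th coefficient gives back at most \<open>i\<close>.\<close>

lemma mat_degree_le_op_poly:
  assumes "mat_degree_le F0 0" "mat_degree_le F1 1" "mat_degree_le F2 2" "mat_degree_le P n"
  shows "mat_degree_le (op_poly P [:F0, F1, F2:]) n"
proof -
  have p0: "degree (p * f) \<le> n" if "degree p \<le> n" "degree f \<le> 0" for p f :: "complex poly"
    using degree_mult_le[of p f] that by linarith
  have p1: "degree (pderiv p * f) \<le> n" if "degree p \<le> n" "degree f \<le> 1" for p f :: "complex poly"
  \<comment> \<open>Constants are set apart: their derivative has degree 0 by convention, not a
    negative one, and the bound by the sum of the degrees would be too weak.\<close>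
  proof (cases "pderiv p = 0")
    case False
    then have "degree p \<noteq> 0" by (simp add: pderiv_eq_0_iff)
    then show ?thesis using degree_mult_le[of "pderiv p" f] that by (simp add: degree_pderiv)
  qed simp
  have p2: "degree (pderiv (pderiv p) * f) \<le> n" if "degree p \<le> n" "degree f \<le> 2" for p f :: "complex poly"
  proof (cases "pderiv (pderiv p) = 0")
    case False
    then have "degree (pderiv p) \<noteq> 0" by (simp add: pderiv_eq_0_iff)
    then show ?thesis using degree_mult_le[of "pderiv (pderiv p)" f] that by (simp add: degree_pderiv)
  qed simp
  have deg: "degree (op_poly P [:F0, F1, F2:] $ i $ j) \<le> n" for i j
  proof -
    have "op_poly P [:F0, F1, F2:] $ i $ j = (\<Sum>k\<in>UNIV. P $ i $ k * F0 $ k $ j)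
        + (\<Sum>k\<in>UNIV. pderiv (P $ i $ k) * F1 $ k $ j)
        + (\<Sum>k\<in>UNIV. pderiv (pderiv (P $ i $ k)) * F2 $ k $ j)"
      by (simp add: op_poly_quadratic matrix_matrix_mult_def pderiv_mat_def)
    also have "degree \<dots> \<le> n"
      using assms unfolding mat_degree_le_def
      by (intro degree_add_le degree_sum_le p0 p1 p2) auto
    finally show ?thesis .
  qed
  then show ?thesis by (simp add: mat_degree_le_def)
qed

subsection \<open>Functions with finite moments\<close>

lemma set_integrable_bounded_linear:
  fixes f :: "'a \<Rightarrow> 'b::{banach, second_countable_topology}"
    and T :: "'b \<Rightarrow> 'c::{banach, second_countable_topology}"
  assumes "bounded_linear T" "set_integrable M I f"
  shows "set_integrable M I (\<lambda>x. T (f x))"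
  using integrable_bounded_linear[OF assms(1) assms(2)[unfolded set_integrable_def]]
  by (simp add: set_integrable_def linear_scale[OF bounded_linear.linear[OF assms(1)]])

lemma set_integral_bounded_linear:
  fixes f :: "'a \<Rightarrow> 'b::{banach, second_countable_topology}"
    and T :: "'b \<Rightarrow> 'c::{banach, second_countable_topology}"
  assumes "bounded_linear T" "set_integrable M I f"
  shows "(LINT x:I|M. T (f x)) = T (LINT x:I|M. f x)"
  using integral_bounded_linear[OF assms(1) assms(2)[unfolded set_integrable_def]]
  by (simp add: set_lebesgue_integral_def linear_scale[OF bounded_linear.linear[OF assms(1)]])

text \<open>All moments are asked for, so that the class is stable under multiplication by matrix
  polynomials on either side.\<close>

definition moments_finite :: "real set \<Rightarrow> (real \<Rightarrow> complex^'n^'m) \<Rightarrow> bool" where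
  "moments_finite I f \<longleftrightarrow> (\<forall>k::nat. set_integrable lborel I (\<lambda>x. x ^ k *\<^sub>R f x))"

lemma moments_finite_integrable: "moments_finite I f \<Longrightarrow> set_integrable lborel I f"
  unfolding moments_finite_def by (drule spec[of _ 0]) simp

lemma moments_finite_bounded_linear:
  assumes "bounded_linear T" "moments_finite I f"
  shows "moments_finite I (\<lambda>x. T (f x))"
  unfolding moments_finite_def
proof
  fix k
  have "set_integrable lborel I (\<lambda>x. T (x ^ k *\<^sub>R f x))"
    using assms(2) by (intro set_integrable_bounded_linear[OF assms(1)]) (simp add: moments_finite_def)
  then show "set_integrable lborel I (\<lambda>x. x ^ k *\<^sub>R T (f x))"
    by (simp add: linear_scale[OF bounded_linear.linear[OF assms(1)]])
qed

lemma moments_finite_0 [simp]: "moments_finite I (\<lambda>x. 0)"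
  by (simp add: moments_finite_def set_integrable_def)

lemma moments_finite_add:
  "moments_finite I f \<Longrightarrow> moments_finite I g \<Longrightarrow> moments_finite I (\<lambda>x. f x + g x)"
  by (simp add: moments_finite_def scaleR_add_right set_integral_add)

lemma moments_finite_diff:
  "moments_finite I f \<Longrightarrow> moments_finite I g \<Longrightarrow> moments_finite I (\<lambda>x. f x - g x)"
  by (simp add: moments_finite_def scaleR_diff_right set_integral_diff)

lemma moments_finite_power:
  "moments_finite I f \<Longrightarrow> moments_finite I (\<lambda>x. x ^ j *\<^sub>R f x)"
  by (simp add: moments_finite_def flip: power_add)

lemma moments_finite_hermitian_conj:
  "moments_finite I f \<Longrightarrow> moments_finite I (\<lambda>x. hermitian_conj (f x))"
  by (rule moments_finite_bounded_linear[OF bounded_linear_hermitian_conj])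

lemma moments_finite_scaleR: "moments_finite I f \<Longrightarrow> moments_finite I (\<lambda>x. c *\<^sub>R f x)"
  by (rule moments_finite_bounded_linear[OF bounded_linear_scaleR_right])

lemma moments_finite_eval_mat_left:
  "moments_finite I f \<Longrightarrow> moments_finite I (\<lambda>x. eval_mat P x ** f x)"
proof (induction P rule: mat_poly_induct)
  case (const_mult A k)
  then have "moments_finite I (\<lambda>x. A ** (x ^ k *\<^sub>R f x))"
    by (intro moments_finite_bounded_linear[OF bounded_linear_matrix_mult_right] moments_finite_power)
  then show ?case by (simp add: eval_mat_mult eval_mat_funpow_shift matrix_scaleR_left matrix_scaleR_right)
qed (simp_all add: eval_mat_add matrix_add_rdistrib moments_finite_add)

lemma moments_finite_eval_mat_right:
  "moments_finite I f \<Longrightarrow> moments_finite I (\<lambda>x. f x ** hermitian_conj (eval_mat Q x))"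
  using moments_finite_hermitian_conj[OF moments_finite_eval_mat_left[OF moments_finite_hermitian_conj]]
  by (simp add: hermitian_conj_mult)

text \<open>The set where two continuous functions differ is open, and a nonempty open set is not
  negligible. Weights are positive definite only almost everywhere; this extends the resulting
  identities to the whole interval.\<close>

lemma continuous_AE_eq_imp_eq:
  fixes f g :: "'a::euclidean_space \<Rightarrow> 'b::real_normed_vector"
  assumes "open S" "continuous_on S f" "continuous_on S g"
    and "AE x in lborel. x \<in> S \<longrightarrow> f x = g x" and "x \<in> S"
  shows "f x = g x"
proof (rule ccontr)
  assume "f x \<noteq> g x"
  define U where "U = S \<inter> (\<lambda>x. f x - g x) -` (- {0})"
  have "open U" unfolding U_def
    by (intro continuous_open_preimage continuous_intros assms)
  moreover have "x \<in> U" using \<open>f x \<noteq> g x\<close> \<open>x \<in> S\<close> by (simp add: U_def)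
  moreover have "negligible U"
  proof -
    obtain N where N: "N \<in> null_sets lborel" "{x \<in> space lborel. \<not> (x \<in> S \<longrightarrow> f x = g x)} \<subseteq> N"
      using assms(4) by (auto simp: eventually_ae_filter)
    then have "negligible N" by (simp add: negligible_iff_null_sets null_sets_completionI)
    then show ?thesis by (rule negligible_subset) (use N(2) in \<open>auto simp: U_def\<close>)
  qed
  ultimately show False using open_not_negligible by blast
qed

subsection \<open>Behaviour at the end points\<close>

lemma einterval_mono: "a \<le> a' \<Longrightarrow> b' \<le> b \<Longrightarrow> einterval a' b' \<subseteq> einterval a b"
  by (auto simp: einterval_iff intro: le_less_trans less_le_trans)

lemma Icc_subset_einterval:
  assumes "c \<in> einterval a b" "d \<in> einterval a b"
  shows "{c..d} \<subseteq> einterval a b"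
proof
  fix x assume "x \<in> {c..d}"
  then have "ereal c \<le> ereal x" "ereal x \<le> ereal d" by auto
  then show "x \<in> einterval a b"
    using assms unfolding einterval_iff by (blast intro: less_le_trans le_less_trans)
qed

text \<open>By the fundamental theorem of calculus \<open>f s - f c\<close> is the integral of
  \<open>f'\<close> from \<open>c\<close> to \<open>s\<close>, and these integrals converge as
  \<open>s\<close> increases to \<open>b\<close> because \<open>f'\<close> is integrable.\<close>

lemma integrable_derivative_limit_left:
  fixes f :: "real \<Rightarrow> 'a::euclidean_space"
  assumes ab: "a < b"
    and f: "\<And>x. x \<in> einterval a b \<Longrightarrow> (f has_vector_derivative f' x) (at x)"
    and cont: "continuous_on (einterval a b) f'" and int: "set_integrable lborel (einterval a b) f'"
  shows "\<exists>L. ((f \<circ> real_of_ereal) \<longlongrightarrow> L) (at_left b)"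
proof -
  obtain c where c: "c \<in> einterval a b" using einterval_nonempty[OF ab] by blast
  then have "a < ereal c" "ereal c < b" by (simp_all add: einterval_iff)
  define J where "J = (LINT x:einterval c b|lborel. f' x)"
  have "((f \<circ> real_of_ereal) \<longlongrightarrow> f c + J) (at_left b)"
  proof (rule tendsto_at_left_sequentially[OF \<open>ereal c < b\<close>])
    fix S :: "nat \<Rightarrow> ereal"
    assume S: "\<And>n. S n < b" "\<And>n. ereal c < S n" "incseq S" "S \<longlonglongrightarrow> b"
    define s where "s n = real_of_ereal (S n)" for n
    have s: "S n = ereal (s n)" for n
      using S(1)[of n] S(2)[of n] by (cases "S n") (auto simp: s_def)
    have U: "(\<Union>n. einterval c (S n)) = einterval c b"
    proof (intro equalityI subsetI)
      fix x assume "x \<in> einterval c b"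
      then have "eventually (\<lambda>n. ereal x < S n) sequentially"
        by (intro order_tendstoD(1)[OF S(4)]) (simp add: einterval_iff)
      then obtain n where "ereal x < S n" using eventually_happens by force
      then show "x \<in> (\<Union>n. einterval c (S n))"
        using \<open>x \<in> einterval c b\<close> by (auto simp: einterval_iff)
    qed (use S(1) less_trans in \<open>auto simp: einterval_iff\<close>)
    have "(\<lambda>n. LINT x:einterval c (S n)|lborel. f' x) \<longlonglongrightarrow> (LINT x:(\<Union>n. einterval c (S n))|lborel. f' x)"
    proof (rule set_integral_cont_up)
      show "incseq (\<lambda>n. einterval c (S n))"
        by (auto simp: incseq_def[of "\<lambda>n. einterval c (S n)"] einterval_iff
          intro: less_le_trans[OF _ incseqD[OF \<open>incseq S\<close>]])
      show "set_integrable lborel (\<Union>n. einterval c (S n)) f'"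
        unfolding U by (rule set_integrable_subset[OF int])
          (simp_all add: einterval_mono \<open>a < ereal c\<close> \<open>ereal c < b\<close> less_imp_le)
    qed auto
    moreover have "(LINT x:einterval c (S n)|lborel. f' x) = f (s n) - f c" for n
    proof -
      have "c < s n" using S(2)[of n] by (simp add: s)
      have sub: "{c..s n} \<subseteq> einterval a b"
        using S(1)[of n] less_trans[OF \<open>a < ereal c\<close> S(2)[of n]] c
        by (intro Icc_subset_einterval) (simp_all add: einterval_iff s)
      have "(LBINT x=c..s n. f' x) = f (s n) - f c"
        using \<open>c < s n\<close> sub
        by (intro interval_integral_FTC_finite)
          (auto intro!: continuous_on_subset[OF cont] has_vector_derivative_at_within f simp: subset_iff)
      then show ?thesis using \<open>c < s n\<close> by (simp add: interval_lebesgue_integral_def s)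
    qed
    ultimately have "(\<lambda>n. f c + (f (s n) - f c)) \<longlonglongrightarrow> f c + J"
      unfolding U J_def by (intro tendsto_add tendsto_const) simp
    then show "(\<lambda>n. (f \<circ> real_of_ereal) (S n)) \<longlonglongrightarrow> f c + J" by (simp add: s)
  qed
  then show ?thesis ..
qed

text \<open>The same argument at the lower end, with the intervals from \<open>s\<close> to
  \<open>c\<close> growing as \<open>s\<close> decreases to \<open>a\<close>.\<close>

lemma integrable_derivative_limit_right:
  fixes f :: "real \<Rightarrow> 'a::euclidean_space"
  assumes ab: "a < b"
    and f: "\<And>x. x \<in> einterval a b \<Longrightarrow> (f has_vector_derivative f' x) (at x)"
    and cont: "continuous_on (einterval a b) f'" and int: "set_integrable lborel (einterval a b) f'"
  shows "\<exists>L. ((f \<circ> real_of_ereal) \<longlongrightarrow> L) (at_right a)"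
proof -
  obtain c where c: "c \<in> einterval a b" using einterval_nonempty[OF ab] by blast
  then have "a < ereal c" "ereal c < b" by (simp_all add: einterval_iff)
  define J where "J = (LINT x:einterval a c|lborel. f' x)"
  have "((f \<circ> real_of_ereal) \<longlongrightarrow> f c - J) (at_right a)"
  proof (rule tendsto_at_right_sequentially[OF \<open>a < ereal c\<close>])
    fix S :: "nat \<Rightarrow> ereal"
    assume S: "\<And>n. a < S n" "\<And>n. S n < ereal c" "decseq S" "S \<longlonglongrightarrow> a"
    define s where "s n = real_of_ereal (S n)" for n
    have s: "S n = ereal (s n)" for n
      using S(1)[of n] S(2)[of n] by (cases "S n") (auto simp: s_def)
    have U: "(\<Union>n. einterval (S n) c) = einterval a c"
    proof (intro equalityI subsetI)
      fix x assume "x \<in> einterval a c"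
      then have "eventually (\<lambda>n. S n < ereal x) sequentially"
        by (intro order_tendstoD(2)[OF S(4)]) (simp add: einterval_iff)
      then obtain n where "S n < ereal x" using eventually_happens by force
      then show "x \<in> (\<Union>n. einterval (S n) c)"
        using \<open>x \<in> einterval a c\<close> by (auto simp: einterval_iff)
    qed (use S(1) less_trans in \<open>auto simp: einterval_iff\<close>)
    have "(\<lambda>n. LINT x:einterval (S n) c|lborel. f' x) \<longlonglongrightarrow> (LINT x:(\<Union>n. einterval (S n) c)|lborel. f' x)"
    proof (rule set_integral_cont_up)
      show "incseq (\<lambda>n. einterval (S n) c)"
        by (auto simp: incseq_def einterval_iff intro: le_less_trans[OF decseqD[OF \<open>decseq S\<close>]])
      show "set_integrable lborel (\<Union>n. einterval (S n) c) f'"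
        unfolding U by (rule set_integrable_subset[OF int])
          (simp_all add: einterval_mono \<open>a < ereal c\<close> \<open>ereal c < b\<close> less_imp_le)
    qed auto
    moreover have "(LINT x:einterval (S n) c|lborel. f' x) = f c - f (s n)" for n
    proof -
      have "s n < c" using S(2)[of n] by (simp add: s)
      have sub: "{s n..c} \<subseteq> einterval a b"
        using S(1)[of n] less_trans[OF S(2)[of n] \<open>ereal c < b\<close>] c
        by (intro Icc_subset_einterval) (simp_all add: einterval_iff s)
      have "(LBINT x=s n..c. f' x) = f c - f (s n)"
        using \<open>s n < c\<close> sub
        by (intro interval_integral_FTC_finite)
          (auto intro!: continuous_on_subset[OF cont] has_vector_derivative_at_within f simp: subset_iff)
      then show ?thesis using \<open>s n < c\<close> by (simp add: interval_lebesgue_integral_def s)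
    qed
    ultimately have "(\<lambda>n. f c - (f c - f (s n))) \<longlonglongrightarrow> f c - J"
      unfolding U J_def by (intro tendsto_diff tendsto_const) simp
    then show "(\<lambda>n. (f \<circ> real_of_ereal) (S n)) \<longlonglongrightarrow> f c - J" by (simp add: s)
  qed
  then show ?thesis ..
qed

section \<open>Limits at finite and infinite end points\<close>

definition endpoint :: "ereal \<Rightarrow> ereal \<Rightarrow> ereal \<Rightarrow> real filter \<Rightarrow> bool" where
  "endpoint x0 x1 e E \<longleftrightarrow>
     e = x1 \<and> E = filtermap real_of_ereal (at_left x1) \<or>
     e = x0 \<and> E = filtermap real_of_ereal (at_right x0)"

text \<open>\<open>x0 < x1\<close> keeps the upper end above minus infinity and the lower end below
  plus infinity, where the one-sided filters would be trivial.\<close>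

lemma endpoint_neq_bot: "x0 < x1 \<Longrightarrow> endpoint x0 x1 e E \<Longrightarrow> E \<noteq> bot"
  by (cases x0; cases x1)
    (auto simp: endpoint_def filtermap_filtermap filtermap_ident eq_commute[of bot]
      at_left_ereal at_right_ereal at_left_PInf at_right_MInf)

lemma endpoint_finite:
  "endpoint x0 x1 (ereal r) E \<Longrightarrow> filterlim (\<lambda>x. x) (nhds r) E"
  by (auto simp: endpoint_def at_left_ereal at_right_ereal filtermap_filtermap filtermap_ident
      filterlim_ident intro: tendsto_ident_at)

lemma endpoint_infinite:
  assumes "x0 < x1" "endpoint x0 x1 e E" "\<bar>e\<bar> = \<infinity>"
  shows "filterlim (\<lambda>x. x) at_infinity E"
proof -
  \<comment> \<open>Because \<open>x0 < x1\<close>, an infinite upper end is plus infinity and an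
    infinite lower end is minus infinity.\<close>
  have "e = x1 \<and> x1 = \<infinity> \<or> e = x0 \<and> x0 = -\<infinity>"
    using assms by (auto simp: endpoint_def)
  then have "E = at_top \<or> E = at_bot"
    using assms by (auto simp: endpoint_def at_left_PInf at_right_MInf filtermap_filtermap)
  then show ?thesis
    using filterlim_at_top_imp_at_infinity[OF filterlim_ident] filterlim_at_bot_imp_at_infinity[OF filterlim_ident]
    by blast
qed

text \<open>Finite moments of the derivative force limits at both ends. Those of the function are
  included because the product rule mixes the two under multiplication by polynomials.\<close>

definition tame :: "ereal \<Rightarrow> ereal \<Rightarrow> (real \<Rightarrow> complex^'n^'m) \<Rightarrow> (real \<Rightarrow> complex^'n^'m) \<Rightarrow> bool" where
  "tame x0 x1 f f' \<longleftrightarrow>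
     (\<forall>x\<in>einterval x0 x1. (f has_vector_derivative f' x) (at x)) \<and>
     continuous_on (einterval x0 x1) f' \<and>
     moments_finite (einterval x0 x1) f \<and> moments_finite (einterval x0 x1) f'"

lemma tame_continuous: "tame x0 x1 f f' \<Longrightarrow> continuous_on (einterval x0 x1) f"
  unfolding tame_def by (intro continuous_on_vector_derivative[of _ f f'])
    (auto intro: has_vector_derivative_at_within)

lemma tame_add: "tame x0 x1 f f' \<Longrightarrow> tame x0 x1 g g' \<Longrightarrow> tame x0 x1 (\<lambda>x. f x + g x) (\<lambda>x. f' x + g' x)"
  unfolding tame_def by (auto intro!: has_vector_derivative_add continuous_on_add moments_finite_add)

lemma tame_diff: "tame x0 x1 f f' \<Longrightarrow> tame x0 x1 g g' \<Longrightarrow> tame x0 x1 (\<lambda>x. f x - g x) (\<lambda>x. f' x - g' x)"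
  unfolding tame_def by (auto intro!: has_vector_derivative_diff continuous_on_diff moments_finite_diff)

lemma tame_scaleR: "tame x0 x1 f f' \<Longrightarrow> tame x0 x1 (\<lambda>x. c *\<^sub>R f x) (\<lambda>x. c *\<^sub>R f' x)"
  unfolding tame_def by (auto intro!: bounded_linear.has_vector_derivative[OF bounded_linear_scaleR_right]
      continuous_intros moments_finite_scaleR)

lemma tame_eval_mat_left:
  assumes "tame x0 x1 f f'"
  shows "tame x0 x1 (\<lambda>x. eval_mat P x ** f x) (\<lambda>x. eval_mat P x ** f' x + eval_mat (pderiv_mat P) x ** f x)"
  using assms tame_continuous[OF assms] unfolding tame_def
  by (auto intro!: has_vector_derivative_matrix_mult has_vector_derivative_eval_mat
      continuous_intros moments_finite_add moments_finite_eval_mat_left)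

lemma tame_eval_mat_right:
  assumes "tame x0 x1 f f'"
  shows "tame x0 x1 (\<lambda>x. f x ** hermitian_conj (eval_mat Q x))
    (\<lambda>x. f x ** hermitian_conj (eval_mat (pderiv_mat Q) x) + f' x ** hermitian_conj (eval_mat Q x))"
  using assms tame_continuous[OF assms] unfolding tame_def
  by (auto intro!: has_vector_derivative_matrix_mult has_vector_derivative_eval_mat
      has_vector_derivative_hermitian_conj
      continuous_intros moments_finite_add moments_finite_eval_mat_right)

lemma tame_limit:
  assumes "x0 < x1" "endpoint x0 x1 e E" "tame x0 x1 f f'"
  shows "\<exists>L. (f \<longlongrightarrow> L) E"
proof -
  have "\<exists>L. ((f \<circ> real_of_ereal) \<longlongrightarrow> L) (at_left x1)"
    "\<exists>L. ((f \<circ> real_of_ereal) \<longlongrightarrow> L) (at_right x0)"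
    using assms unfolding tame_def
    by (auto intro!: integrable_derivative_limit_left[of x0 x1 f f']
        integrable_derivative_limit_right[of x0 x1 f f'] moments_finite_integrable)
  then show ?thesis using assms(2) by (auto simp: endpoint_def filterlim_filtermap o_def)
qed

text \<open>Since \<open>x f(x)\<close> has a finite limit as well, the limit of \<open>f\<close> at an infinite end point is zero.\<close>

lemma tame_limit_infinite:
  assumes "x0 < x1" "endpoint x0 x1 e E" "tame x0 x1 f f'" "\<bar>e\<bar> = \<infinity>"
  shows "(f \<longlongrightarrow> 0) E"
proof -
  have inf: "filterlim (\<lambda>x. x) at_infinity E" by (rule endpoint_infinite) fact+
  obtain L where L: "((\<lambda>x. eval_mat (mat_shift (mat 1)) x ** f x) \<longlongrightarrow> L) E"
    using tame_limit[OF assms(1,2) tame_eval_mat_left[OF assms(3)]] by blast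
  have "((\<lambda>x. inverse x *\<^sub>R (eval_mat (mat_shift (mat 1)) x ** f x)) \<longlongrightarrow> 0 *\<^sub>R L) E"
    by (intro tendsto_scaleR L filterlim_compose[OF tendsto_inverse_0 inf])
  moreover have "eventually (\<lambda>x. inverse x *\<^sub>R (eval_mat (mat_shift (mat 1)) x ** f x) = f x) E"
    using inf eventually_not_equal_at_infinity[of 0] unfolding filterlim_iff
    by (auto elim!: eventually_mono simp: eval_mat_shift matrix_scaleR_left)
  ultimately show ?thesis by (simp add: tendsto_cong)
qed

text \<open>At a finite end point the polynomial factors converge. At an infinite one the whole
  product is again tame and so tends to zero, whatever the growth of \<open>P\<close> and
  \<open>Q\<close>.\<close>

lemma tame_limit_0:
  assumes "x0 < x1" "endpoint x0 x1 e E" "tame x0 x1 f f'" "(f \<longlongrightarrow> 0) E"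
  shows "((\<lambda>x. eval_mat P x ** f x ** hermitian_conj (eval_mat Q x)) \<longlongrightarrow> 0) E"
proof (cases e)
  case (real r)
  have lim: "(eval_mat R \<longlongrightarrow> eval_mat R r) E" for R :: "complex poly^'x^'y"
    using continuous_on_eval_mat[of UNIV R] endpoint_finite[of x0 x1 r E] assms(2) real
    by (auto simp: continuous_on_eq_continuous_at isCont_def intro: isCont_tendsto_compose[of r "eval_mat R" "\<lambda>x. x"] )
  have "((\<lambda>x. eval_mat P x ** f x ** hermitian_conj (eval_mat Q x)) \<longlongrightarrow>
      eval_mat P r ** 0 ** hermitian_conj (eval_mat Q r)) E"
    by (intro tendsto_intros lim assms)
  then show ?thesis by simp
qed (auto intro!: tame_limit_infinite[OF assms(1,2)] tame_eval_mat_right tame_eval_mat_left assms(3))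

subsection \<open>The matrix-valued inner product\<close>

lemma nth_deriv_0 [simp]: "nth_deriv 0 f = f"
  and nth_deriv_Suc: "nth_deriv (Suc k) f x = vector_derivative (nth_deriv k f) (at x)"
  by (simp_all add: nth_deriv_def)

text \<open>The diagonal entry of \<open>K ** A ** hermitian_conj K\<close> at \<open>a\<close> is
  the quadratic form of \<open>A\<close> at the conjugate of row \<open>a\<close> of
  \<open>K\<close>.\<close>

lemma positive_definite_row:
  assumes "positive_definite A"
  shows "0 \<le> Re ((K ** A ** hermitian_conj K) $ a $ a)"
    and "Re ((K ** A ** hermitian_conj K) $ a $ a) = 0 \<Longrightarrow> K $ a $ i = 0"
proof -
  define v where "v = (\<chi> i. cnj (K $ a $ i))"
  define s where "s = (\<Sum>i\<in>UNIV. \<Sum>j\<in>UNIV. cnj (v $ i) * A $ i $ j * v $ j)"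
  have "(K ** A ** hermitian_conj K) $ a $ a = s"
    unfolding matrix_matrix_mult_def s_def v_def
    by (simp add: sum_distrib_right) (rule sum.swap)
  moreover have "Re s = 0" if "v = 0" using that by (simp add: s_def)
  moreover have "0 < Re s" if "v \<noteq> 0"
    using assms that by (simp add: positive_definite_def s_def)
  moreover have "K $ a $ i = 0" if "v = 0"
    using that by (simp add: v_def vec_eq_iff)
  ultimately show "0 \<le> Re ((K ** A ** hermitian_conj K) $ a $ a)"
    and "Re ((K ** A ** hermitian_conj K) $ a $ a) = 0 \<Longrightarrow> K $ a $ i = 0"
    by (cases "v = 0"; force)+
qed

lemma positive_definite_invertible:
  assumes "positive_definite A"
  shows "invertible A"
proof -
  have "v = 0" if "A *v v = 0" for v
  proof (rule ccontr)
    assume "v \<noteq> 0"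
    then have "0 < Re (\<Sum>i\<in>UNIV. \<Sum>j\<in>UNIV. cnj (v $ i) * A $ i $ j * v $ j)"
      using assms by (simp add: positive_definite_def)
    also have "(\<Sum>i\<in>UNIV. \<Sum>j\<in>UNIV. cnj (v $ i) * A $ i $ j * v $ j) = (\<Sum>i\<in>UNIV. cnj (v $ i) * (A *v v) $ i)"
      by (simp add: matrix_vector_mult_def sum_distrib_left mult.assoc)
    finally show False using that by simp
  qed
  then show ?thesis
    by (simp add: invertible_left_inverse matrix_left_invertible_ker)
qed

lemma infinite_einterval: "x0 < x1 \<Longrightarrow> infinite (einterval x0 x1)"
  using einterval_nonempty[of x0 x1] finite_imp_not_open[of "einterval x0 x1"] by auto

locale weight =
  fixes x0 x1 :: ereal and W :: "real \<Rightarrow> complex^'n^'n"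
  assumes less: "x0 < x1" and weight: "weight_matrix x0 x1 W"
begin

abbreviation I :: "real set" where "I \<equiv> einterval x0 x1"

abbreviation ip :: "complex poly^'n^'m \<Rightarrow> complex poly^'n^'k \<Rightarrow> complex^'k^'m" where
  "ip \<equiv> weight_inner x0 x1 W"

lemma moments_finite_weight: "moments_finite I W"
  using weight less_imp_le[OF less] by (simp add: weight_matrix_def moments_finite_def interval_lebesgue_integrable_def)

lemma has_vector_derivative_weight:
  "x \<in> I \<Longrightarrow> (nth_deriv k W has_vector_derivative nth_deriv (Suc k) W x) (at x)"
  using weight by (simp add: weight_matrix_def nth_deriv_Suc vector_derivative_works[symmetric])

lemma continuous_on_weight: "continuous_on I (nth_deriv k W)"
  by (rule continuous_on_vector_derivative)
    (auto intro: has_vector_derivative_at_within has_vector_derivative_weight)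

lemma AE_positive_definite: "AE x in lborel. x \<in> I \<longrightarrow> positive_definite (W x)"
  using weight by (simp add: weight_matrix_def)

lemma hermitian_conj_weight:
  assumes "x \<in> I"
  shows "hermitian_conj (W x) = W x"
proof (rule continuous_AE_eq_imp_eq[OF open_einterval _ _ _ assms])
  show "continuous_on I W" "continuous_on I (\<lambda>x. hermitian_conj (W x))"
    using continuous_on_weight[of 0] by (auto intro: continuous_intros)
  show "AE x in lborel. x \<in> I \<longrightarrow> hermitian_conj (W x) = W x"
    using AE_positive_definite by eventually_elim (simp add: positive_definite_def)
qed

lemma ip_eq: "ip P Q = (LINT x:I|lborel. eval_mat P x ** W x ** hermitian_conj (eval_mat Q x))"
  using less_imp_le[OF less] by (simp add: weight_inner_def interval_lebesgue_integral_def)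

lemma moments_finite_ip:
  "moments_finite I (\<lambda>x. eval_mat P x ** W x ** hermitian_conj (eval_mat Q x))"
  by (intro moments_finite_eval_mat_right moments_finite_eval_mat_left moments_finite_weight)

lemmas integrable_ip = moments_finite_integrable[OF moments_finite_ip]

lemma ip_add_left: "ip (P + R) Q = ip P Q + ip R Q"
  and ip_add_right: "ip P (Q + S) = ip P Q + ip P S"
  and ip_diff_left: "ip (P - R) Q = ip P Q - ip R Q"
  by (simp_all add: ip_eq eval_mat_add eval_mat_diff hermitian_conj_add hermitian_conj_diff
      matrix_distribs set_integral_add(2) set_integral_diff(2) integrable_ip)

lemma ip_0_left [simp]: "ip 0 Q = 0"
  and ip_0_right [simp]: "ip P 0 = 0"
  by (simp_all add: ip_eq set_lebesgue_integral_def)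

lemma ip_const_mult_left: "ip (const_mat A ** P) Q = A ** ip P Q"
  using set_integral_bounded_linear[OF bounded_linear_matrix_mult_right[of A] integrable_ip[of P Q]]
  by (simp add: ip_eq eval_mat_mult matrix_mul_assoc)

lemma ip_const_mult_right: "ip P (const_mat A ** Q) = ip P Q ** hermitian_conj A"
  using set_integral_bounded_linear[OF bounded_linear_matrix_mult_left[of "hermitian_conj A"] integrable_ip[of P Q]]
  by (simp add: ip_eq eval_mat_mult matrix_mul_assoc hermitian_conj_mult)

lemma ip_hermitian_conj: "hermitian_conj (ip P Q) = ip Q P"
proof -
  have "ip Q P = (LINT x:I|lborel. hermitian_conj (eval_mat P x ** W x ** hermitian_conj (eval_mat Q x)))"
    unfolding ip_eq
    by (rule set_lebesgue_integral_cong)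
      (auto simp: hermitian_conj_mult matrix_mul_assoc hermitian_conj_weight)
  then show ?thesis
    by (simp add: ip_eq set_integral_bounded_linear[OF bounded_linear_hermitian_conj integrable_ip])
qed

text \<open>\<open>x\<close> is a real scalar, so it passes through the weight and is unchanged by
  conjugation. The commutator argument for adjoints rests on this symmetry.\<close>

lemma ip_shift: "ip (mat_shift P) Q = ip P (mat_shift Q)"
  by (simp add: ip_eq eval_mat_shift hermitian_conj_scaleR matrix_distribs)

text \<open>The diagonal entries of the integrand are nonnegative almost everywhere with zero
  integral, so the rows of \<open>R\<close> vanish almost everywhere, and by continuity on the whole
  interval. A polynomial with infinitely many zeros is zero.\<close>

lemma ip_definite:
  fixes R :: "complex poly^'n^'m"
  assumes "ip R R = 0"
  shows "R = 0"
proof -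
  let ?M = "\<lambda>x. eval_mat R x ** W x ** hermitian_conj (eval_mat R x)"
  { fix a i
    have lin: "bounded_linear (\<lambda>M :: complex^'m^'m. Re (M $ a $ a))"
      by (intro linear_conv_bounded_linear[THEN iffD1] linearI) simp_all
    have nonneg: "AE x in lborel. 0 \<le> indicator I x *\<^sub>R Re (?M x $ a $ a)"
      using AE_positive_definite
      by eventually_elim (auto simp: positive_definite_row indicator_def)
    have "(LINT x:I|lborel. Re (?M x $ a $ a)) = 0"
      unfolding set_integral_bounded_linear[OF lin integrable_ip] using assms by (simp add: ip_eq)
    moreover have "set_integrable lborel I (\<lambda>x. Re (?M x $ a $ a))"
      by (rule set_integrable_bounded_linear[OF lin integrable_ip])
    ultimately have "AE x in lborel. indicator I x *\<^sub>R Re (?M x $ a $ a) = 0"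
      unfolding set_lebesgue_integral_def set_integrable_def
      using integral_nonneg_eq_0_iff_AE[OF _ nonneg] by blast
    with AE_positive_definite
    have AE: "AE x in lborel. x \<in> I \<longrightarrow> eval_mat R x $ a $ i = 0"
      by eventually_elim (auto simp: positive_definite_row(2))
    have "eval_mat R x $ a $ i = 0" if "x \<in> I" for x
      by (rule continuous_AE_eq_imp_eq[OF open_einterval _ _ AE that])
        (intro continuous_intros)+
    then have "\<forall>x\<in>I. poly (R $ a $ i) (of_real x) = 0"
      by (simp add: eval_mat_def)
    then have "of_real ` I \<subseteq> {z. poly (R $ a $ i) z = 0}" by auto
    moreover have "infinite ((of_real :: real \<Rightarrow> complex) ` I)"
      using infinite_einterval[OF less] by (simp add: finite_image_iff inj_on_def)
    ultimately have "R $ a $ i = 0"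
      using finite_subset poly_roots_finite by blast }
  then show ?thesis by (simp add: vec_eq_iff)
qed

lemma invertible_ip_self:
  fixes R :: "complex poly^'n^'n"
  assumes "invertible (coeff_mat R n)"
  shows "invertible (ip R R)"
proof -
  have "v = 0" if v: "ip R R *v v = 0" for v
  proof -
    \<comment> \<open>Every row of \<open>K\<close> is the conjugate of the kernel vector, so
      \<open>const_mat K ** R\<close> is orthogonal to itself and vanishes; its coefficient at
      \<open>n\<close> then forces \<open>K = 0\<close>.\<close>
    define K :: "complex^'n^'n" where "K = (\<chi> a i. cnj (v $ i))"
    have "ip R R ** hermitian_conj K = 0"
      using v by (simp add: K_def vec_eq_iff matrix_matrix_mult_def matrix_vector_mult_def)
    then have "ip (const_mat K ** R) (const_mat K ** R) = 0"
      by (simp add: ip_const_mult_left ip_const_mult_right flip: matrix_mul_assoc)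
    then have "const_mat K ** R = 0" by (rule ip_definite)
    then have "coeff_mat (const_mat K ** R) n = 0" by simp
    then have "K = 0"
      using invertible_0_left[OF _ assms] by (simp add: coeff_mat_const_mult)
    then show "v = 0" by (simp add: K_def vec_eq_iff)
  qed
  then show ?thesis by (simp add: invertible_left_inverse matrix_left_invertible_ker)
qed

section \<open>Matrix-valued orthogonal polynomials and expansions in them\<close>

lemma orthogonal_projection:
  fixes R :: "complex poly^'n^'n"
  shows "\<exists>S. mat_degree_less S n \<and> (\<forall>Q :: complex poly^'n^'n. mat_degree_less Q n \<longrightarrow> ip (R - S) Q = 0)"
proof (induction n arbitrary: R)
  case 0
  then show ?case by auto
next
  case (Suc n)
  \<comment> \<open>Gram-Schmidt: the induction hypothesis for \<open>x^n I\<close> gives a monic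
    \<open>P\<close> orthogonal to all lower degrees, and for \<open>R\<close> a projection that
    remains to be corrected along \<open>P\<close>.\<close>
  let ?X = "(mat_shift ^^ n) (mat 1) :: complex poly^'n^'n"
  obtain T where T: "mat_degree_less T n"
      "\<And>Q :: complex poly^'n^'n. mat_degree_less Q n \<Longrightarrow> ip (?X - T) Q = 0"
    using Suc.IH[of ?X] by blast
  obtain S where S: "mat_degree_less S n"
      "\<And>Q :: complex poly^'n^'n. mat_degree_less Q n \<Longrightarrow> ip (R - S) Q = 0"
    using Suc.IH[of R] by blast
  define P where "P = ?X - T"
  have P: "mat_degree_less P (Suc n)" "coeff_mat P n = mat 1"
    using T(1) by (auto simp: P_def mat_degree_less_def coeff_mat_diff coeff_mat_funpow_shift_1)
  then have inv: "invertible (coeff_mat P n)" by (simp add: invertible_mat)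
  \<comment> \<open>The coefficient of \<open>R - S\<close> along \<open>P\<close>; the inverse
    exists because \<open>P\<close> is monic.\<close>
  define C where "C = ip (R - S) P ** matrix_inv (ip P P)"
  have C: "C ** ip P P = ip (R - S) P"
    using invertible_ip_self[OF inv] by (simp add: C_def matrix_inv_left flip: matrix_mul_assoc)
  show ?case
  proof (intro exI[of _ "S + const_mat C ** P"] conjI allI impI)
    show "mat_degree_less (S + const_mat C ** P) (Suc n)"
      using S(1) P(1) by (simp add: mat_degree_less_add mat_degree_less_const_mult mat_degree_less_mono)
    fix Q :: "complex poly^'n^'n" assume "mat_degree_less Q (Suc n)"
    then obtain A Q' where Q: "Q = const_mat A ** P + Q'" "mat_degree_less Q' n"
      using mat_degree_less_split P(1) inv by blast
    have "ip (R - (S + const_mat C ** P)) Z = ip (R - S) Z - C ** ip P Z" for Z :: "complex poly^'n^'n"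
      by (simp add: ip_diff_left ip_add_left ip_const_mult_left)
    then have "ip (R - (S + const_mat C ** P)) P = 0" "ip (R - (S + const_mat C ** P)) Q' = 0"
      using C S(2)[OF Q(2)] T(2)[OF Q(2)] by (simp_all add: P_def)
    then show "ip (R - (S + const_mat C ** P)) Q = 0"
      by (simp add: Q(1) ip_add_right ip_const_mult_right)
  qed
qed

text \<open>Subtracting from \<open>x^n I\<close> its projection onto lower degrees gives the
  \<open>n\<close>-th polynomial. Membership in \<open>op_module\<close> asks for some pair of
  sequences, so existence has to be secured.\<close>

lemma orthogonal_polys_exist: "\<exists>P. orthogonal_polys x0 x1 W P"
proof -
  have "\<exists>P. mat_degree_less P (Suc n) \<and> coeff_mat P n = mat 1 \<and>
      (\<forall>Q :: complex poly^'n^'n. mat_degree_less Q n \<longrightarrow> ip P Q = 0)" for n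
  proof -
    let ?X = "(mat_shift ^^ n) (mat 1) :: complex poly^'n^'n"
    obtain T where T: "mat_degree_less T n"
      "\<And>Q :: complex poly^'n^'n. mat_degree_less Q n \<Longrightarrow> ip (?X - T) Q = 0"
      using orthogonal_projection[where R = ?X] by blast
    have "mat_degree_less (?X - T) (Suc n)" "coeff_mat (?X - T) n = mat 1"
      using T(1) by (auto simp: mat_degree_less_def coeff_mat_diff coeff_mat_funpow_shift_1)
    with T(2) show ?thesis by blast
  qed
  then obtain P where P: "\<And>n. mat_degree_less (P n) (Suc n)" "\<And>n. coeff_mat (P n) n = mat 1"
    "\<And>n Q. mat_degree_less Q n \<Longrightarrow> ip (P n) (Q :: complex poly^'n^'n) = 0"
    by metis
  have "ip (P n) (P m) = 0" if "n \<noteq> m" for n m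
  proof (cases "m < n")
    case True
    then show ?thesis using P(1)[of m] by (intro P(3)) (auto intro: mat_degree_less_mono)
  next
    case False
    with that have "ip (P m) (P n) = 0"
      using P(1)[of n] by (intro P(3)) (auto intro: mat_degree_less_mono)
    then show ?thesis by (metis hermitian_conj_0 ip_hermitian_conj)
  qed
  then show ?thesis
    using P(1,2) by (auto simp: orthogonal_polys_def mat_degree_le_iff_less invertible_mat intro!: exI[of _ P])
qed

context
  fixes P :: "nat \<Rightarrow> complex poly^'n^'n"
  assumes orth: "orthogonal_polys x0 x1 W P"
begin

lemma orthogonal_polys_degree: "mat_degree_less (P n) (Suc n)"
  and orthogonal_polys_lead: "invertible (coeff_mat (P n) n)"
  and orthogonal_polys_ip: "n \<noteq> m \<Longrightarrow> ip (P n) (P m) = 0"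
  and invertible_ip_orthogonal_polys: "invertible (ip (P n) (P n))"
  using orth invertible_ip_self unfolding orthogonal_polys_def mat_degree_le_iff_less by blast+

lemma orthogonal_polys_split:
  assumes "mat_degree_less Q (Suc n)"
  obtains A Q' where "Q = const_mat A ** P n + Q'" "mat_degree_less Q' n"
  using mat_degree_less_split[OF assms orthogonal_polys_degree orthogonal_polys_lead] .

lemma ip_orthogonal_polys_less:
  "mat_degree_less Q m \<Longrightarrow> m \<le> n \<Longrightarrow> ip (P n) Q = 0"
proof (induction m arbitrary: Q)
  case (Suc m)
  obtain A Q' where "Q = const_mat A ** P m + Q'" "mat_degree_less Q' m"
    using orthogonal_polys_split[OF Suc.prems(1)] .
  then show ?case
    using Suc by (simp add: ip_add_right ip_const_mult_right orthogonal_polys_ip)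
qed simp

text \<open>Pairing with the top polynomial isolates the leading term in the expansion of
  \<open>R\<close>, the rest being orthogonal to it, and invertibility of
  \<open>ip (P n) (P n)\<close> removes that term.\<close>

lemma eq_0_if_orthogonal:
  "mat_degree_less R n \<Longrightarrow> (\<And>m. m < n \<Longrightarrow> ip R (P m) = 0) \<Longrightarrow> R = 0"
proof (induction n arbitrary: R)
  case (Suc n)
  obtain A R' where R: "R = const_mat A ** P n + R'" "mat_degree_less R' n"
    using orthogonal_polys_split[OF Suc.prems(1)] .
  have "ip (P n) R' = 0" using ip_orthogonal_polys_less[OF R(2)] by simp
  then have "ip R' (P n) = 0" by (metis hermitian_conj_0 ip_hermitian_conj)
  then have "A ** ip (P n) (P n) = 0"
    using Suc.prems(2)[of n] by (simp add: R(1) ip_add_left ip_const_mult_left)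
  then have "A = 0" using invertible_0_left invertible_ip_orthogonal_polys by blast
  then show ?case using R Suc.IH[of R'] Suc.prems(2) by simp
qed simp

end

end

subsection \<open>Adjoints of operators of order two\<close>

definition adjoint_ops :: "ereal \<Rightarrow> ereal \<Rightarrow> (real \<Rightarrow> complex^'n1^'n1) \<Rightarrow> (real \<Rightarrow> complex^'n2^'n2) \<Rightarrow>
    ('n1, 'n2) diff_op \<Rightarrow> ('n2, 'n1) diff_op \<Rightarrow> bool" where
  "adjoint_ops x0 x1 W Wt V N \<longleftrightarrow> (\<forall>(P :: complex poly^'n1^'n1) (Q :: complex poly^'n2^'n2).
     weight_inner x0 x1 Wt (op_poly P V) Q = weight_inner x0 x1 W P (op_poly Q N))"

locale weight_pair = A: weight x0 x1 W + B: weight x0 x1 Wt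
  for x0 x1 :: ereal and W :: "real \<Rightarrow> complex^'n1^'n1" and Wt :: "real \<Rightarrow> complex^'n2^'n2"
begin

lemma adjoint_ops_swap: "adjoint_ops x0 x1 W Wt V N \<Longrightarrow> adjoint_ops x0 x1 Wt W N V"
  unfolding adjoint_ops_def by (metis A.ip_hermitian_conj B.ip_hermitian_conj)

text \<open>Constant factors \<open>K\<close> and \<open>L\<close> bring \<open>P\<close> and
  \<open>Q\<close> to the square shapes used in \<open>adjoint_ops\<close>; being arbitrary, they
  can be stripped off again. The column blocks arising for the direct sum are rectangular and need
  this form.\<close>

lemma adjoint_ops_arbitrary_rows:
  fixes P :: "complex poly^'n1^'k" and Q :: "complex poly^'n2^'l"
    and F0 F1 F2 :: "complex poly^'n2^'n1" and G0 G1 G2 :: "complex poly^'n1^'n2"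
  assumes "adjoint_ops x0 x1 W Wt [:F0, F1, F2:] [:G0, G1, G2:]"
  shows "B.ip (op_poly P [:F0, F1, F2:]) Q = A.ip P (op_poly Q [:G0, G1, G2:])"
proof -
  define D where "D = B.ip (op_poly P [:F0, F1, F2:]) Q - A.ip P (op_poly Q [:G0, G1, G2:])"
  have "K ** D ** hermitian_conj L = 0" for K :: "complex^'k^'n1" and L :: "complex^'l^'n2"
  proof -
    have "B.ip (op_poly (const_mat K ** P) [:F0, F1, F2:]) (const_mat L ** Q) =
        A.ip (const_mat K ** P) (op_poly (const_mat L ** Q) [:G0, G1, G2:])"
      using assms by (simp add: adjoint_ops_def)
    then show ?thesis
      by (simp add: D_def op_poly_quadratic_const_mult A.ip_const_mult_left A.ip_const_mult_right
          B.ip_const_mult_left B.ip_const_mult_right matrix_distribs matrix_mul_assoc)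
  qed
  then have "K ** (D ** hermitian_conj L) = 0" for K :: "complex^'k^'n1" and L :: "complex^'l^'n2"
    by (simp add: matrix_mul_assoc)
  then have "D ** hermitian_conj L = 0" for L :: "complex^'l^'n2"
    by (rule matrix_eq_0_left)
  then have "L ** hermitian_conj D = 0" for L :: "complex^'l^'n2"
    by (metis hermitian_conj_0 hermitian_conj_hermitian_conj hermitian_conj_mult)
  then have "hermitian_conj D = 0" by (rule matrix_eq_0_left)
  then have "D = 0" by (metis hermitian_conj_0 hermitian_conj_hermitian_conj)
  then show ?thesis by (simp add: D_def)
qed

text \<open>The image of \<open>P n\<close> has degree at most \<open>n\<close>, and its pairing
  with \<open>Pt m\<close> for \<open>m < n\<close> becomes one of \<open>P n\<close> with a
  polynomial of degree at most \<open>m\<close>, which vanishes. Only the component along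
  \<open>Pt n\<close> survives.\<close>

lemma op_module_if_adjoint:
  fixes F0 F1 F2 :: "complex poly^'n2^'n1" and G0 G1 G2 :: "complex poly^'n1^'n2"
  assumes "adjoint_ops x0 x1 W Wt [:F0, F1, F2:] [:G0, G1, G2:]"
    and F: "mat_degree_le F0 0" "mat_degree_le F1 1" "mat_degree_le F2 2"
    and G: "mat_degree_le G0 0" "mat_degree_le G1 1" "mat_degree_le G2 2"
  shows "[:F0, F1, F2:] \<in> op_module x0 x1 W Wt"
proof -
  obtain P Pt where P: "orthogonal_polys x0 x1 W P" and Pt: "orthogonal_polys x0 x1 Wt Pt"
    using A.orthogonal_polys_exist B.orthogonal_polys_exist by blast
  have "\<exists>A :: complex^'n2^'n1. op_poly (P n) [:F0, F1, F2:] = const_mat A ** Pt n" for n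
  proof -
    have "mat_degree_less (op_poly (P n) [:F0, F1, F2:]) (Suc n)"
      using mat_degree_le_op_poly[OF F, of "P n" n] A.orthogonal_polys_degree[OF P]
      by (simp add: mat_degree_le_iff_less)
    then obtain A R where R: "op_poly (P n) [:F0, F1, F2:] = const_mat A ** Pt n + R"
      "mat_degree_less R n"
      by (rule B.orthogonal_polys_split[OF Pt])
    have "R = 0"
    proof (rule B.eq_0_if_orthogonal[OF Pt R(2)])
      fix m assume "m < n"
      have "mat_degree_less (op_poly (Pt m) [:G0, G1, G2:]) (Suc m)"
        using mat_degree_le_op_poly[OF G, of "Pt m" m] B.orthogonal_polys_degree[OF Pt]
        by (simp add: mat_degree_le_iff_less)
      then have "A.ip (P n) (op_poly (Pt m) [:G0, G1, G2:]) = 0"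
        using \<open>m < n\<close> by (intro A.ip_orthogonal_polys_less[OF P]) auto
      then have "B.ip (op_poly (P n) [:F0, F1, F2:]) (Pt m) = 0"
        using assms(1) by (simp add: adjoint_ops_def)
      then show "B.ip R (Pt m) = 0"
        using \<open>m < n\<close> by (simp add: R(1) B.ip_add_left B.ip_const_mult_left B.orthogonal_polys_ip[OF Pt])
    qed
    then show ?thesis using R(1) by auto
  qed
  with P Pt show ?thesis unfolding op_module_def by blast
qed

text \<open>\<open>V\<close> sends \<open>P n\<close> to a multiple of \<open>Pt n\<close>, so the
  adjoint map sends \<open>Pt n\<close> to a multiple of \<open>P n\<close> and is extended
  linearly. The common bound on \<open>Q\<close> and \<open>R\<close> records that degrees are not
  raised.\<close>

lemma adjoint_element_exists:
  fixes F0 F1 F2 :: "complex poly^'n2^'n1" and Q :: "complex poly^'n2^'n2"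
  assumes "[:F0, F1, F2:] \<in> op_module x0 x1 W Wt" "mat_degree_less Q n"
  shows "\<exists>R :: complex poly^'n1^'n2. mat_degree_less R n \<and>
    (\<forall>P :: complex poly^'n1^'n1. B.ip (op_poly P [:F0, F1, F2:]) Q = A.ip P R)"
proof -
  let ?V = "[:F0, F1, F2:]"
  obtain P Pt A where P: "orthogonal_polys x0 x1 W P" and Pt: "orthogonal_polys x0 x1 Wt Pt"
    and A: "\<And>n. op_poly (P n) ?V = const_mat (A n :: complex^'n2^'n1) ** Pt n"
    using assms(1) unfolding op_module_def by (auto dest!: choice)
  \<comment> \<open>\<open>C n\<close> solves \<open><P n, P n> (C n)^* = A n <Pt n, Pt n>\<close>,
    which is adjointness on the pair \<open>P n\<close>, \<open>Pt n\<close>.\<close>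
  define C where "C n = hermitian_conj (matrix_inv (A.ip (P n) (P n)) ** A n ** B.ip (Pt n) (Pt n))" for n
  have C: "A.ip (P n) (P n) ** hermitian_conj (C n) = A n ** B.ip (Pt n) (Pt n)" for n
    using matrix_inv_right[OF A.invertible_ip_orthogonal_polys[OF P, of n]]
    by (simp add: C_def matrix_mul_assoc)
  have *: "B.ip (op_poly Z ?V) (Pt n) = A.ip Z (const_mat (C n) ** P n)"
    for Z :: "complex poly^'n1^'n1" and n
  proof -
    have "mat_degree_less Z m \<Longrightarrow> B.ip (op_poly Z ?V) (Pt n) = A.ip Z (const_mat (C n) ** P n)" for m
    proof (induction m arbitrary: Z)
      case (Suc m)
      obtain K Z' where Z: "Z = const_mat K ** P m + Z'" "mat_degree_less Z' m"
        using A.orthogonal_polys_split[OF P Suc.prems] .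
      \<comment> \<open>For \<open>m \<noteq> n\<close> both sides vanish by orthogonality; for
        \<open>m = n\<close> this is the choice of \<open>C n\<close>.\<close>
      have "A m ** B.ip (Pt m) (Pt n) = A.ip (P m) (P n) ** hermitian_conj (C n)"
        by (cases "m = n") (simp_all add: C A.orthogonal_polys_ip[OF P] B.orthogonal_polys_ip[OF Pt])
      then have "B.ip (op_poly (P m) ?V) (Pt n) = A.ip (P m) (const_mat (C n) ** P n)"
        by (simp add: A A.ip_const_mult_right B.ip_const_mult_left)
      then show ?case
        using Suc.IH[OF Z(2)]
        by (simp add: Z(1) op_poly_quadratic_add op_poly_quadratic_const_mult
            A.ip_add_left B.ip_add_left A.ip_const_mult_left B.ip_const_mult_left)
    qed simp
    then show ?thesis using mat_degree_less_ex by blast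
  qed
  show ?thesis using assms(2)
  proof (induction n arbitrary: Q)
    case 0
    then show ?case by (auto intro!: exI[of _ 0])
  next
    case (Suc n)
    obtain K Q' where Q: "Q = const_mat K ** Pt n + Q'" "mat_degree_less Q' n"
      using B.orthogonal_polys_split[OF Pt Suc.prems] .
    obtain R' :: "complex poly^'n1^'n2" where R': "mat_degree_less R' n"
      "\<And>P. B.ip (op_poly (P :: complex poly^'n1^'n1) ?V) Q' = A.ip P R'"
      using Suc.IH[OF Q(2)] by blast
    let ?R = "const_mat K ** (const_mat (C n) ** P n) + R'"
    have "mat_degree_less ?R (Suc n)"
      using R'(1) A.orthogonal_polys_degree[OF P]
      by (simp add: mat_degree_less_add mat_degree_less_const_mult mat_degree_less_mono)
    moreover have "B.ip (op_poly Z ?V) Q = A.ip Z ?R" for Z :: "complex poly^'n1^'n1"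
      by (simp add: Q(1) A.ip_add_right B.ip_add_right B.ip_const_mult_right * R'(2)
          A.ip_const_mult_right[of Z K])
    ultimately show ?case by blast
  qed
qed

text \<open>The adjoint of \<open>V\<close> as a linear map has vanishing third commutator with \<open>x\<close>, so it is
  the operator of order two that agrees with it on \<open>1\<close>, \<open>x\<close> and \<open>x\<^sup>2\<close>.\<close>

lemma adjoint_exists:
  fixes F0 F1 F2 :: "complex poly^'n2^'n1"
  assumes "[:F0, F1, F2:] \<in> op_module x0 x1 W Wt"
  shows "\<exists>G0 G1 G2. mat_degree_le G0 0 \<and> mat_degree_le G1 1 \<and> mat_degree_le G2 2 \<and>
    adjoint_ops x0 x1 W Wt [:F0, F1, F2:] [:G0, G1, G2:]"
proof -
  let ?V = "[:F0, F1, F2:]"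
  let ?X = "\<lambda>k. (mat_shift ^^ k) (mat 1) :: complex poly^'n2^'n2"
  have "mat_degree_less (?X k) (Suc k)" for k
    by (auto simp: mat_degree_less_def coeff_mat_funpow_shift_1)
  from adjoint_element_exists[OF assms this]
  obtain R :: "nat \<Rightarrow> complex poly^'n1^'n2" where R: "\<And>k. mat_degree_less (R k) (Suc k)"
    "\<And>k P. B.ip (op_poly (P :: complex poly^'n1^'n1) ?V) (?X k) = A.ip P (R k)"
    by metis
  \<comment> \<open>The coefficients solve a triangular system: an operator of order two sends
    \<open>1\<close>, \<open>x\<close>, \<open>x^2\<close> to \<open>G0\<close>,
    \<open>x G0 + G1\<close>, \<open>x^2 G0 + 2 x G1 + 2 G2\<close>.\<close>
  define G0 where "G0 = R 0"
  define G1 where "G1 = R 1 - mat_shift G0"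
  define H where "H = R 2 - mat_shift (mat_shift G0) - (mat_shift G1 + mat_shift G1)"
  define G2 where "G2 = const_mat (mat (1/2)) ** H"
  let ?N = "[:G0, G1, G2:]"
  have "(const_mat (mat (1/2)) :: complex poly^'n2^'n2) + const_mat (mat (1/2)) = mat 1"
  proof -
    have "[:1/2:] + [:1/2:] = (1 :: complex poly)" unfolding one_pCons by (subst add_pCons) simp
    then show ?thesis by (simp only: const_mat_def mat_def vec_eq_iff vec_lambda_beta
          vector_add_component if_distrib[of "\<lambda>z. [:z:]"] split: if_split) simp
  qed
  then have G2: "G2 + G2 = H"
    by (simp add: G2_def flip: matrix_add_rdistrib)
  have G: "mat_degree_less G0 (Suc 0)" "mat_degree_less G1 (Suc 1)" "mat_degree_less G2 (Suc 2)"
  proof -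
    show 0: "mat_degree_less G0 (Suc 0)" using R(1)[of 0] by (simp add: G0_def)
    show 1: "mat_degree_less G1 (Suc 1)" using R(1)[of 1] mat_degree_less_shift[OF 0]
      by (simp add: G1_def mat_degree_less_diff)
    show "mat_degree_less G2 (Suc 2)"
      using R(1)[of 2] mat_degree_less_shift[OF 1] mat_degree_less_shift[OF mat_degree_less_shift[OF 0]]
      unfolding G2_def H_def numeral_2_eq_2
      by (intro mat_degree_less_const_mult mat_degree_less_diff mat_degree_less_add) simp_all
  qed
  have N: "op_poly (?X k) ?N = R k" if "k \<le> 2" for k
  proof -
    have "op_poly (?X 2) ?N = mat_shift (mat_shift G0) + (mat_shift G1 + mat_shift G1) + (G2 + G2)"
      by (simp only: op_poly_quadratic numeral_2_eq_2 funpow.simps o_apply id_apply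
          pderiv_mat_shift pderiv_mat_add pderiv_mat_1 mat_shift_0 add_0_left add_0_right
          mat_shift_mult_left matrix_add_rdistrib matrix_mul_lid)
    then have "op_poly (?X 2) ?N = R 2" by (simp add: G2 H_def)
    moreover have "op_poly (?X 1) ?N = R 1" "op_poly (?X 0) ?N = R 0"
      by (simp_all add: op_poly_quadratic pderiv_mat_shift mat_shift_mult_left G1_def G0_def)
    moreover have "k = 0 \<or> k = 1 \<or> k = 2" using that by auto
    ultimately show ?thesis by blast
  qed
  define ok where "ok Q \<longleftrightarrow> (\<forall>P :: complex poly^'n1^'n1. B.ip (op_poly P ?V) Q = A.ip P (op_poly Q ?N))"
    for Q :: "complex poly^'n2^'n2"
  have step: "ok (mat_shift (mat_shift (mat_shift Q)))"
    if "ok Q" "ok (mat_shift Q)" "ok (mat_shift (mat_shift Q))" for Q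
    unfolding ok_def
  proof
    fix P :: "complex poly^'n1^'n1"
    \<comment> \<open>\<open>b\<close>, \<open>c\<close>, \<open>d\<close> are the terms shared by
      the commutator identity for \<open>N\<close> at \<open>Q\<close>, paired with
      \<open>P\<close>, and the one for \<open>V\<close> at \<open>P\<close>, paired with
      \<open>Q\<close>. The symmetry of \<open>x\<close> and the three known cases match them, and
      comparing what remains gives the claim for \<open>x^3 Q\<close>.\<close>
    define b where "b = A.ip P (mat_shift (mat_shift (op_poly (mat_shift Q) ?N)))"
    define c where "c = A.ip P (mat_shift (op_poly (mat_shift (mat_shift Q)) ?N))"
    define d where "d = A.ip P (mat_shift (mat_shift (mat_shift (op_poly Q ?N))))"
    have ok: "B.ip (op_poly Z ?V) Q = A.ip Z (op_poly Q ?N)"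
      "B.ip (op_poly Z ?V) (mat_shift Q) = A.ip Z (op_poly (mat_shift Q) ?N)"
      "B.ip (op_poly Z ?V) (mat_shift (mat_shift Q)) = A.ip Z (op_poly (mat_shift (mat_shift Q)) ?N)"
      for Z :: "complex poly^'n1^'n1"
      using that by (simp_all only: ok_def)
    have "A.ip P (op_poly (mat_shift (mat_shift (mat_shift Q))) ?N) + (b + b + b) = (c + c + c) + d"
      using arg_cong[OF op_poly_quadratic_shift3[of Q G0 G1 G2], of "A.ip P"]
      by (simp only: A.ip_add_right b_def c_def d_def)
    moreover have "d + (c + c + c) = (b + b + b) + B.ip (op_poly P ?V) (mat_shift (mat_shift (mat_shift Q)))"
      using arg_cong[OF op_poly_quadratic_shift3[of P F0 F1 F2], of "\<lambda>U. B.ip U Q"]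
      by (simp only: B.ip_add_left B.ip_shift ok A.ip_shift b_def c_def d_def)
    ultimately
    show "B.ip (op_poly P ?V) (mat_shift (mat_shift (mat_shift Q))) =
        A.ip P (op_poly (mat_shift (mat_shift (mat_shift Q))) ?N)"
      by (metis add.commute add_left_cancel)
  qed
  have "ok (?X k)" for k
  proof (induction k rule: less_induct)
    case (less k)
    show ?case
    proof (cases "k \<le> 2")
      case True
      then show ?thesis using R(2) N by (simp add: ok_def)
    next
      case False
      then have "k = Suc (Suc (Suc (k - 3)))" by simp
      then obtain j where k: "k = Suc (Suc (Suc j))" ..
      show ?thesis
        using step[of "?X j"] less[of j] less[of "Suc j"] less[of "Suc (Suc j)"] by (simp add: k)
    qed
  qed
  then have "ok Q" for Q
    by (induction Q rule: mat_poly_induct)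
      (simp_all add: ok_def op_poly_quadratic_add op_poly_quadratic_const_mult A.ip_add_right
        B.ip_add_right A.ip_const_mult_right B.ip_const_mult_right)
  then show ?thesis
    using G by (auto simp: ok_def adjoint_ops_def mat_degree_le_iff_less)
qed

end

subsection \<open>Integration by parts\<close>

lemma nth_deriv_Suc_0I:
  "(g has_vector_derivative d) (at x) \<Longrightarrow> nth_deriv (Suc 0) g x = d"
  by (simp add: nth_deriv_Suc vector_derivative_at)

lemma has_vector_derivative_nth_deriv:
  assumes "open S" "x \<in> S" "\<And>t. t \<in> S \<Longrightarrow> (g has_vector_derivative g' t) (at t)"
    and "(g' has_vector_derivative d) (at x)"
  shows "(nth_deriv (Suc 0) g has_vector_derivative d) (at x)"
  by (rule has_vector_derivative_transform_within_open[OF assms(4,1,2)])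
    (simp add: nth_deriv_Suc_0I[OF assms(3)])

text \<open>Integration by parts at a point: \<open>P0\<close>, \<open>P1\<close>, \<open>P2\<close>
  stand for \<open>P\<close>, \<open>P'\<close>, \<open>P''\<close> and \<open>q0\<close>,
  \<open>q1\<close>, \<open>q2\<close> for the conjugates of those of \<open>Q\<close>;
  \<open>M\<close> is \<open>M2\<close>, \<open>a\<close> and \<open>b\<close> are
  \<open>F0 Wt\<close> and \<open>F1 Wt\<close>, \<open>w0\<close> and \<open>w1\<close> are
  \<open>W G0^*\<close> and \<open>W G1^*\<close>. The left side is the derivative of the boundary
  form, the right side the difference of the integrands.\<close>

lemma boundary_form_identity:
  fixes M w1 b :: "complex^'n^'m"
  shows "(P1 ** M ** q1 + (P1 ** ((1/2) *\<^sub>R (w1 + b)) + P2 ** M) ** q0)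
      - (P0 ** M ** q2 + (P0 ** ((1/2) *\<^sub>R (w1 + b)) + P1 ** M) ** q1)
      + (1/2) *\<^sub>R (P0 ** (b - w1) ** q1 + (P0 ** (2 *\<^sub>R (a - w0)) + P1 ** (b - w1)) ** q0)
    = (P0 ** a ** q0 + P1 ** b ** q0 + P2 ** M ** q0) - (P0 ** w0 ** q0 + P0 ** w1 ** q1 + P0 ** M ** q2)"
  unfolding matrix_distribs vec_eq_iff
  by (simp add: scaleR_conv_of_real[where 'a=complex] field_simps)

section \<open>Derivatives of a weight times a conjugated matrix polynomial\<close>

context weight begin

text \<open>Taken for \<open>Wt\<close>, these are the functions differentiated on the right of the
  symmetry equations.\<close>

definition weighted :: "complex poly^'n^'m \<Rightarrow> real \<Rightarrow> complex^'m^'n" where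
  "weighted F t = W t ** hermitian_conj (eval_mat F t)"

lemma has_vector_derivative_weighted:
  assumes "x \<in> I"
  shows "((\<lambda>t. nth_deriv k W t ** hermitian_conj (eval_mat F t)) has_vector_derivative
    nth_deriv k W x ** hermitian_conj (eval_mat (pderiv_mat F) x) +
    nth_deriv (Suc k) W x ** hermitian_conj (eval_mat F x)) (at x)"
  by (intro has_vector_derivative_matrix_mult has_vector_derivative_weight assms
      has_vector_derivative_hermitian_conj has_vector_derivative_eval_mat)

lemma nth_deriv_weighted:
  assumes "x \<in> I"
  shows "nth_deriv (Suc 0) (weighted F) x = weighted (pderiv_mat F) x +
      nth_deriv (Suc 0) W x ** hermitian_conj (eval_mat F x)"
    and "(weighted F has_vector_derivative nth_deriv (Suc 0) (weighted F) x) (at x)"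
    and "nth_deriv (Suc (Suc 0)) (weighted F) x = weighted (pderiv_mat (pderiv_mat F)) x +
      2 *\<^sub>R (nth_deriv (Suc 0) W x ** hermitian_conj (eval_mat (pderiv_mat F) x)) +
      nth_deriv (Suc (Suc 0)) W x ** hermitian_conj (eval_mat F x)"
    and "(nth_deriv (Suc 0) (weighted F) has_vector_derivative nth_deriv (Suc (Suc 0)) (weighted F) x) (at x)"
proof -
  have 1: "(weighted F has_vector_derivative weighted (pderiv_mat F) t +
      nth_deriv (Suc 0) W t ** hermitian_conj (eval_mat F t)) (at t)"
    if "t \<in> I" for t and F :: "complex poly^'n^'k"
    using has_vector_derivative_weighted[OF that, of 0 F] by (simp add: weighted_def[abs_def])
  show "nth_deriv (Suc 0) (weighted F) x = weighted (pderiv_mat F) x +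
      nth_deriv (Suc 0) W x ** hermitian_conj (eval_mat F x)"
    by (rule nth_deriv_Suc_0I[OF 1[OF assms]])
  then show "(weighted F has_vector_derivative nth_deriv (Suc 0) (weighted F) x) (at x)"
    using 1[OF assms] by simp
  have "(nth_deriv (Suc 0) (weighted F) has_vector_derivative
      (weighted (pderiv_mat (pderiv_mat F)) x + nth_deriv (Suc 0) W x ** hermitian_conj (eval_mat (pderiv_mat F) x))
      + (nth_deriv (Suc 0) W x ** hermitian_conj (eval_mat (pderiv_mat F) x) +
        nth_deriv (Suc (Suc 0)) W x ** hermitian_conj (eval_mat F x))) (at x)"
    \<comment> \<open>The first derivative agrees with the product rule formula on the whole open
      interval, so that formula may be differentiated in its place.\<close>
    by (rule has_vector_derivative_nth_deriv[OF open_einterval assms 1])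
      (assumption, intro has_vector_derivative_add 1 has_vector_derivative_weighted assms)
  note 2 = this
  then have 3: "nth_deriv (Suc (Suc 0)) (weighted F) x =
      (weighted (pderiv_mat (pderiv_mat F)) x + nth_deriv (Suc 0) W x ** hermitian_conj (eval_mat (pderiv_mat F) x))
      + (nth_deriv (Suc 0) W x ** hermitian_conj (eval_mat (pderiv_mat F) x) +
        nth_deriv (Suc (Suc 0)) W x ** hermitian_conj (eval_mat F x))"
    by (simp add: nth_deriv_Suc vector_derivative_at)
  with 2 show "(nth_deriv (Suc 0) (weighted F) has_vector_derivative nth_deriv (Suc (Suc 0)) (weighted F) x) (at x)"
    by simp
  show "nth_deriv (Suc (Suc 0)) (weighted F) x = weighted (pderiv_mat (pderiv_mat F)) x +
      2 *\<^sub>R (nth_deriv (Suc 0) W x ** hermitian_conj (eval_mat (pderiv_mat F) x)) +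
      nth_deriv (Suc (Suc 0)) W x ** hermitian_conj (eval_mat F x)"
    unfolding 3 by (simp add: scaleR_2 add_ac)
qed

lemma continuous_on_weighted:
  "continuous_on I (weighted F)"
  "continuous_on I (nth_deriv (Suc 0) (weighted F))"
  "continuous_on I (nth_deriv (Suc (Suc 0)) (weighted F))"
proof -
  have c: "continuous_on I (\<lambda>t. nth_deriv k W t ** hermitian_conj (eval_mat F t))"
    for k and F :: "complex poly^'n^'m"
    by (intro continuous_intros continuous_on_weight)
  show w: "continuous_on I (weighted F)" for F :: "complex poly^'n^'m"
    using c[of 0 F] by (simp add: weighted_def[abs_def])
  have "continuous_on I (\<lambda>x. weighted (pderiv_mat F) x +
      nth_deriv (Suc 0) W x ** hermitian_conj (eval_mat F x))"
    by (intro continuous_on_add w c)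
  then show "continuous_on I (nth_deriv (Suc 0) (weighted F))"
    by (simp add: nth_deriv_weighted(1) cong: continuous_on_cong)
  have "continuous_on I (\<lambda>x. weighted (pderiv_mat (pderiv_mat F)) x +
      2 *\<^sub>R (nth_deriv (Suc 0) W x ** hermitian_conj (eval_mat (pderiv_mat F) x)) +
      nth_deriv (Suc (Suc 0)) W x ** hermitian_conj (eval_mat F x))"
    by (intro continuous_on_add continuous_on_scaleR continuous_on_const w c)
  then show "continuous_on I (nth_deriv (Suc (Suc 0)) (weighted F))"
    by (simp add: nth_deriv_weighted(3) cong: continuous_on_cong)
qed

lemma hermitian_conj_weighted: "x \<in> I \<Longrightarrow> hermitian_conj (weighted F x) = eval_mat F x ** W x"
  by (simp add: weighted_def hermitian_conj_mult hermitian_conj_weight)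

lemma weighted_shift: "weighted (mat_shift F) x = x *\<^sub>R weighted F x"
  by (simp add: weighted_def eval_mat_shift hermitian_conj_scaleR matrix_distribs)

text \<open>The product rule for the factor \<open>x\<close>. It expresses the equations obtained
  from the test polynomials \<open>x\<close> and \<open>x^2\<close> through derivatives for the
  unshifted coefficients.\<close>

lemma nth_deriv_weighted_shift:
  assumes "x \<in> I"
  shows "nth_deriv (Suc 0) (weighted (mat_shift F)) x = weighted F x + x *\<^sub>R nth_deriv (Suc 0) (weighted F) x"
    and "nth_deriv (Suc (Suc 0)) (weighted (mat_shift F)) x =
      2 *\<^sub>R nth_deriv (Suc 0) (weighted F) x + x *\<^sub>R nth_deriv (Suc (Suc 0)) (weighted F) x"
  by (simp_all only: nth_deriv_weighted(1,3)[OF assms] weighted_def pderiv_mat_shift pderiv_mat_add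
      eval_mat_add eval_mat_shift hermitian_conj_add hermitian_conj_scaleR matrix_distribs scaleR_2
      scaleR_add_right add_ac)

end

section \<open>The boundary form of a pair satisfying the symmetry equations\<close>

locale symmetric_pair = weight_pair x0 x1 W Wt
  for x0 x1 :: ereal and W :: "real \<Rightarrow> complex^'n1^'n1" and Wt :: "real \<Rightarrow> complex^'n2^'n2" +
  fixes F0 F1 F2 :: "complex poly^'n2^'n1" and G0 G1 G2 :: "complex poly^'n1^'n2"
  assumes sym: "symmetry_equations x0 x1 W Wt F0 F1 F2 G0 G1 G2"
begin

abbreviation I :: "real set" where "I \<equiv> einterval x0 x1"

lemma sym_eqs:
  assumes "x \<in> I"
  shows "eval_mat G2 x ** W x = B.weighted F2 x"
    "eval_mat G1 x ** W x = 2 *\<^sub>R nth_deriv (Suc 0) (B.weighted F2) x - B.weighted F1 x"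
    "eval_mat G0 x ** W x = nth_deriv (Suc (Suc 0)) (B.weighted F2) x
      - nth_deriv (Suc 0) (B.weighted F1) x + B.weighted F0 x"
  using sym assms by (simp_all add: symmetry_equations_def Let_def B.weighted_def[abs_def] numeral_2_eq_2)

text \<open>\<open>M2'\<close> and \<open>M1'\<close> are the derivatives that the symmetry equations force on \<open>M2\<close> and \<open>M1\<close>,
  written without derivatives of the weights so that their moments are visibly finite.\<close>

definition M2 :: "real \<Rightarrow> complex^'n2^'n1" where
  "M2 x = eval_mat F2 x ** Wt x"

definition M2' :: "real \<Rightarrow> complex^'n2^'n1" where
  "M2' x = (1/2) *\<^sub>R (W x ** hermitian_conj (eval_mat G1 x) + eval_mat F1 x ** Wt x)"

definition M1 :: "real \<Rightarrow> complex^'n2^'n1" where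
  "M1 x = eval_mat F1 x ** Wt x - W x ** hermitian_conj (eval_mat G1 x)"

definition M1' :: "real \<Rightarrow> complex^'n2^'n1" where
  "M1' x = 2 *\<^sub>R (eval_mat F0 x ** Wt x - W x ** hermitian_conj (eval_mat G0 x))"

text \<open>Conjugated, the second symmetry equation says that twice the derivative of
  \<open>F2 Wt\<close> is \<open>W G1^* + F1 Wt\<close>.\<close>

lemma tame_M2: "tame x0 x1 M2 M2'"
proof -
  have "(M2 has_vector_derivative M2' x) (at x)" if "x \<in> I" for x
  proof (rule has_vector_derivative_transform_within_open[OF _ open_einterval that])
    show "((\<lambda>t. hermitian_conj (B.weighted F2 t)) has_vector_derivative M2' x) (at x)"
    proof -
      have "nth_deriv (Suc 0) (B.weighted F2) x = (1/2) *\<^sub>R (eval_mat G1 x ** W x + B.weighted F1 x)"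
        using sym_eqs(2)[OF that] by simp
      then have "hermitian_conj (nth_deriv (Suc 0) (B.weighted F2) x) = M2' x"
        using that by (simp add: M2'_def hermitian_conj_scaleR hermitian_conj_add B.hermitian_conj_weighted
            hermitian_conj_mult A.hermitian_conj_weight)
      then show ?thesis
        using has_vector_derivative_hermitian_conj[OF B.nth_deriv_weighted(2)[OF that, of F2]] by simp
    qed
    show "hermitian_conj (B.weighted F2 t) = M2 t" if "t \<in> I" for t
      using that by (simp add: M2_def B.hermitian_conj_weighted)
  qed
  moreover have "continuous_on I M2'"
    unfolding M2'_def using A.continuous_on_weight[of 0] B.continuous_on_weight[of 0]
    by (auto intro!: continuous_intros)
  moreover have "moments_finite I M2" "moments_finite I M2'"
    unfolding M2_def M2'_def
    by (intro moments_finite_scaleR moments_finite_add moments_finite_eval_mat_left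
        moments_finite_eval_mat_right A.moments_finite_weight B.moments_finite_weight)+
  ultimately show ?thesis by (simp add: tame_def)
qed

text \<open>The second symmetry equation rewrites \<open>M1\<close> as
  \<open>2 (F1 Wt - (F2 Wt)')\<close>, and the third one gives the derivative of this.\<close>

lemma tame_M1: "tame x0 x1 M1 M1'"
proof -
  have "(M1 has_vector_derivative M1' x) (at x)" if "x \<in> I" for x
  proof (rule has_vector_derivative_transform_within_open[OF _ open_einterval that])
    let ?f = "\<lambda>t. 2 *\<^sub>R (B.weighted F1 t - nth_deriv (Suc 0) (B.weighted F2) t)"
    let ?f' = "2 *\<^sub>R (nth_deriv (Suc 0) (B.weighted F1) x - nth_deriv (Suc (Suc 0)) (B.weighted F2) x)"
    have f: "(?f has_vector_derivative ?f') (at x)"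
      by (intro bounded_linear.has_vector_derivative[OF bounded_linear_scaleR_right]
          has_vector_derivative_diff B.nth_deriv_weighted(2,4) that)
    have f': "hermitian_conj ?f' = M1' x"
    proof -
      have "?f' = 2 *\<^sub>R (B.weighted F0 x - eval_mat G0 x ** W x)"
        using sym_eqs(3)[OF that] by simp
      then show ?thesis
        using that by (simp add: M1'_def hermitian_conj_scaleR hermitian_conj_diff B.hermitian_conj_weighted
            hermitian_conj_mult A.hermitian_conj_weight)
    qed
    show "((\<lambda>t. hermitian_conj (?f t)) has_vector_derivative M1' x) (at x)"
      using has_vector_derivative_hermitian_conj[OF f] unfolding f' .
    show "hermitian_conj (?f t) = M1 t" if "t \<in> I" for t
    proof -
      have "?f t = B.weighted F1 t - eval_mat G1 t ** W t"
        using sym_eqs(2)[OF that] by (simp add: scaleR_diff_right scaleR_2)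
      then show ?thesis
        using that by (simp add: M1_def hermitian_conj_diff B.hermitian_conj_weighted
            hermitian_conj_mult A.hermitian_conj_weight)
    qed
  qed
  moreover have "continuous_on I M1'"
    unfolding M1'_def using A.continuous_on_weight[of 0] B.continuous_on_weight[of 0]
    by (auto intro!: continuous_intros)
  moreover have "moments_finite I M1" "moments_finite I M1'"
    unfolding M1_def M1'_def
    by (intro moments_finite_scaleR moments_finite_diff moments_finite_eval_mat_left
        moments_finite_eval_mat_right A.moments_finite_weight B.moments_finite_weight)+
  ultimately show ?thesis by (simp add: tame_def)
qed

definition boundary_form :: "complex poly^'n1^'k \<Rightarrow> complex poly^'n2^'l \<Rightarrow> real \<Rightarrow> complex^'l^'k" where
  "boundary_form P Q x = eval_mat (pderiv_mat P) x ** M2 x ** hermitian_conj (eval_mat Q x)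
     - eval_mat P x ** M2 x ** hermitian_conj (eval_mat (pderiv_mat Q) x)
     + (1/2) *\<^sub>R (eval_mat P x ** M1 x ** hermitian_conj (eval_mat Q x))"

text \<open>The product rule gives the derivative of the boundary form, and the symmetry equations
  turn it into the difference of the integrands of the two inner products.\<close>

lemma tame_boundary_form:
  obtains u where "tame x0 x1 (boundary_form P Q) u"
    "\<And>x. x \<in> I \<Longrightarrow> u x =
      eval_mat (op_poly P [:F0, F1, F2:]) x ** Wt x ** hermitian_conj (eval_mat Q x)
      - eval_mat P x ** W x ** hermitian_conj (eval_mat (op_poly Q [:G0, G1, G2:]) x)"
proof
  let ?P0 = "eval_mat P" and ?P1 = "eval_mat (pderiv_mat P)" and ?P2 = "eval_mat (pderiv_mat (pderiv_mat P))"
  let ?q0 = "\<lambda>x. hermitian_conj (eval_mat Q x)" and ?q1 = "\<lambda>x. hermitian_conj (eval_mat (pderiv_mat Q) x)"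
    and ?q2 = "\<lambda>x. hermitian_conj (eval_mat (pderiv_mat (pderiv_mat Q)) x)"
  let ?u = "\<lambda>x. (?P1 x ** M2 x ** ?q1 x + (?P1 x ** M2' x + ?P2 x ** M2 x) ** ?q0 x)
      - (?P0 x ** M2 x ** ?q2 x + (?P0 x ** M2' x + ?P1 x ** M2 x) ** ?q1 x)
      + (1/2) *\<^sub>R (?P0 x ** M1 x ** ?q1 x + (?P0 x ** M1' x + ?P1 x ** M1 x) ** ?q0 x)"
  show "tame x0 x1 (boundary_form P Q) ?u"
    unfolding boundary_form_def
    by (intro tame_add tame_diff tame_scaleR tame_eval_mat_right tame_eval_mat_left tame_M1 tame_M2)
  fix x assume "x \<in> I"
  \<comment> \<open>By the first symmetry equation \<open>M2\<close> is both \<open>F2 Wt\<close>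
    and \<open>W G2^*\<close>, so it serves the second order terms of \<open>V\<close> and of
    \<open>N\<close>.\<close>
  have "hermitian_conj (eval_mat G2 x ** W x) = hermitian_conj (B.weighted F2 x)"
    using sym_eqs(1)[OF \<open>x \<in> I\<close>] by simp
  then have M2: "W x ** hermitian_conj (eval_mat G2 x) = M2 x"
    using \<open>x \<in> I\<close> by (simp add: M2_def B.hermitian_conj_weighted hermitian_conj_mult A.hermitian_conj_weight)
  have "?u x = (?P0 x ** (eval_mat F0 x ** Wt x) ** ?q0 x
      + ?P1 x ** (eval_mat F1 x ** Wt x) ** ?q0 x + ?P2 x ** M2 x ** ?q0 x)
    - (?P0 x ** (W x ** hermitian_conj (eval_mat G0 x)) ** ?q0 x
      + ?P0 x ** (W x ** hermitian_conj (eval_mat G1 x)) ** ?q1 x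
      + ?P0 x ** M2 x ** ?q2 x)"
    unfolding M2'_def M1_def M1'_def by (rule boundary_form_identity)
  also have "\<dots> = eval_mat (op_poly P [:F0, F1, F2:]) x ** Wt x ** hermitian_conj (eval_mat Q x)
      - eval_mat P x ** (W x ** hermitian_conj (eval_mat G0 x) ** ?q0 x
      + W x ** hermitian_conj (eval_mat G1 x) ** ?q1 x
      + M2 x ** ?q2 x)"
    by (simp add: op_poly_quadratic eval_mat_add eval_mat_mult M2_def matrix_add_rdistrib
        matrix_add_ldistrib matrix_mul_assoc)
  also have "W x ** hermitian_conj (eval_mat G0 x) ** ?q0 x + W x ** hermitian_conj (eval_mat G1 x) ** ?q1 x
      + M2 x ** ?q2 x = W x ** hermitian_conj (eval_mat (op_poly Q [:G0, G1, G2:]) x)"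
    unfolding M2[symmetric]
    by (simp add: op_poly_quadratic eval_mat_add eval_mat_mult hermitian_conj_add hermitian_conj_mult
        matrix_add_ldistrib matrix_mul_assoc)
  finally show "?u x = eval_mat (op_poly P [:F0, F1, F2:]) x ** Wt x ** hermitian_conj (eval_mat Q x)
      - eval_mat P x ** W x ** hermitian_conj (eval_mat (op_poly Q [:G0, G1, G2:]) x)"
    by (simp only: matrix_mul_assoc)
qed

text \<open>The fundamental theorem of calculus with limits at the ends: the defect of adjointness
  is the jump of the boundary form from one end to the other.\<close>

lemma ip_diff_eq_boundary:
  assumes "(boundary_form P Q \<longlongrightarrow> a) (filtermap real_of_ereal (at_right x0))"
    and "(boundary_form P Q \<longlongrightarrow> b) (filtermap real_of_ereal (at_left x1))"
  shows "B.ip (op_poly P [:F0, F1, F2:]) Q - A.ip P (op_poly Q [:G0, G1, G2:]) = b - a"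
proof -
  obtain u where u: "tame x0 x1 (boundary_form P Q) u" "\<And>x. x \<in> I \<Longrightarrow> u x =
      eval_mat (op_poly P [:F0, F1, F2:]) x ** Wt x ** hermitian_conj (eval_mat Q x)
      - eval_mat P x ** W x ** hermitian_conj (eval_mat (op_poly Q [:G0, G1, G2:]) x)"
    using tame_boundary_form[of P Q] by blast
  have "(LBINT x=x0..x1. u x) = b - a"
  proof (rule interval_integral_FTC_integrable[OF A.less])
    show "set_integrable lborel I u"
      using u(1) by (simp add: tame_def moments_finite_integrable)
    show "(boundary_form P Q has_vector_derivative u x) (at x)" "isCont u x" if "x0 < ereal x" "ereal x < x1" for x
      using u(1) that by (auto simp: tame_def einterval_iff continuous_on_eq_continuous_at)
    show "((boundary_form P Q \<circ> real_of_ereal) \<longlongrightarrow> a) (at_right x0)"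
      "((boundary_form P Q \<circ> real_of_ereal) \<longlongrightarrow> b) (at_left x1)"
      using assms by (simp_all add: filterlim_filtermap o_def)
  qed
  moreover have "(LBINT x=x0..x1. u x) = (LINT x:I|lborel.
      eval_mat (op_poly P [:F0, F1, F2:]) x ** Wt x ** hermitian_conj (eval_mat Q x)
      - eval_mat P x ** W x ** hermitian_conj (eval_mat (op_poly Q [:G0, G1, G2:]) x))"
    using less_imp_le[OF A.less] u(2)
    by (auto simp: interval_lebesgue_integral_def intro!: set_lebesgue_integral_cong)
  moreover have "\<dots> = B.ip (op_poly P [:F0, F1, F2:]) Q - A.ip P (op_poly Q [:G0, G1, G2:])"
    unfolding A.ip_eq B.ip_eq by (rule set_integral_diff(2)[OF B.integrable_ip A.integrable_ip])
  ultimately show ?thesis by simp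
qed

lemma boundary_conditions_iff:
  "boundary_conditions x0 x1 W Wt F1 F2 G1 \<longleftrightarrow>
    (\<forall>e E. endpoint x0 x1 e E \<longrightarrow> (M2 \<longlongrightarrow> 0) E \<and> (M1 \<longlongrightarrow> 0) E)"
  unfolding boundary_conditions_def endpoint_def Let_def
  by (auto simp: filterlim_filtermap o_def M2_def[abs_def] M1_def[abs_def])

text \<open>Each term of the boundary form is \<open>M2\<close> or \<open>M1\<close> between
  polynomial factors and vanishes at both ends, so there is no jump.\<close>

lemma adjoint_ops_if_boundary_conditions:
  assumes "boundary_conditions x0 x1 W Wt F1 F2 G1"
  shows "adjoint_ops x0 x1 W Wt [:F0, F1, F2:] [:G0, G1, G2:]"
proof -
  have "(boundary_form P Q \<longlongrightarrow> 0) E" if E: "endpoint x0 x1 e E"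
    for e E and P :: "complex poly^'n1^'n1" and Q :: "complex poly^'n2^'n2"
  proof -
    have M: "(M2 \<longlongrightarrow> 0) E" "(M1 \<longlongrightarrow> 0) E" using assms E boundary_conditions_iff by auto
    have "(boundary_form P Q \<longlongrightarrow> 0 - 0 + (1/2) *\<^sub>R 0) E"
      unfolding boundary_form_def
      by (intro tendsto_add tendsto_diff tendsto_scaleR tendsto_const
          tame_limit_0[OF A.less E tame_M2 M(1)] tame_limit_0[OF A.less E tame_M1 M(2)])
    then show ?thesis by simp
  qed
  then have "B.ip (op_poly P [:F0, F1, F2:]) Q - A.ip P (op_poly Q [:G0, G1, G2:]) = 0 - 0"
    for P :: "complex poly^'n1^'n1" and Q :: "complex poly^'n2^'n2"
    by (intro ip_diff_eq_boundary) (auto simp: endpoint_def)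
  then show ?thesis by (simp add: adjoint_ops_def)
qed

lemma boundary_form_limit_finite:
  assumes "endpoint x0 x1 (ereal r) E" "(M2 \<longlongrightarrow> a) E" "(M1 \<longlongrightarrow> b) E"
  shows "(boundary_form P Q \<longlongrightarrow> eval_mat (pderiv_mat P) r ** a ** hermitian_conj (eval_mat Q r)
     - eval_mat P r ** a ** hermitian_conj (eval_mat (pderiv_mat Q) r)
     + (1/2) *\<^sub>R (eval_mat P r ** b ** hermitian_conj (eval_mat Q r))) E"
proof -
  have lim: "(eval_mat R \<longlongrightarrow> eval_mat R r) E" for R :: "complex poly^'x^'y"
    using isCont_tendsto_compose[OF _ endpoint_finite[OF assms(1)], of "eval_mat R"]
      continuous_on_eval_mat[of UNIV R] by (simp add: continuous_on_eq_continuous_at)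
  show ?thesis
    unfolding boundary_form_def by (intro tendsto_add tendsto_diff tendsto_scaleR tendsto_const
        tendsto_matrix_mult tendsto_hermitian_conj assms lim)
qed

text \<open>Test polynomials vanishing to second order at the opposite end point isolate the limits at \<open>e\<close>.\<close>

lemma boundary_limits_0:
  assumes E: "endpoint x0 x1 e E" and E': "endpoint x0 x1 e' E'" and "e \<noteq> e'"
    and limits: "\<And>(P :: complex poly^'n1^'n1) (Q :: complex poly^'n2^'n2).
      \<exists>L. (boundary_form P Q \<longlongrightarrow> L) E \<and> (boundary_form P Q \<longlongrightarrow> L) E'"
  shows "(M2 \<longlongrightarrow> 0) E \<and> (M1 \<longlongrightarrow> 0) E"
proof (cases "\<bar>e\<bar> = \<infinity>")
  case True
  then show ?thesis
    using tame_limit_infinite[OF A.less E tame_M2] tame_limit_infinite[OF A.less E tame_M1] by simp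
next
  case False
  then obtain r where r: "e = ereal r" by auto
  obtain a b where ab: "(M2 \<longlongrightarrow> a) E" "(M1 \<longlongrightarrow> b) E"
    using tame_limit[OF A.less E] tame_M2 tame_M1 by blast
  \<comment> \<open>A finite opposite end point gets a double zero, where both \<open>P\<close> and
    \<open>P'\<close> then vanish; at an infinite one every boundary form already tends to zero, so
    \<open>1\<close> suffices.\<close>
  define p :: "complex poly" where
    "p = (if \<bar>e'\<bar> = \<infinity> then 1 else [:- of_real (real_of_ereal e'), 1:] ^ 2)"
  have p: "poly p (of_real r) \<noteq> 0"
    using \<open>e \<noteq> e'\<close> by (cases e') (auto simp: p_def r)
  \<comment> \<open>With \<open>Q = 1\<close> the term in \<open>Q'\<close> drops out. The limit
    zero at \<open>e'\<close> carries over to \<open>e\<close> and leaves one relation between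
    \<open>a\<close> and \<open>b\<close> for each \<open>s\<close>.\<close>
  have *: "mat (poly (pderiv (p * s)) (of_real r)) ** a + (1/2) *\<^sub>R (mat (poly (p * s) (of_real r)) ** b) = 0"
    for s
  proof -
    let ?P = "mat (p * s) :: complex poly^'n1^'n1" and ?Q = "mat 1 :: complex poly^'n2^'n2"
    have "(boundary_form ?P ?Q \<longlongrightarrow> 0) E'"
    proof (cases "\<bar>e'\<bar> = \<infinity>")
      case True
      then show ?thesis using tame_limit_infinite[OF A.less E'] tame_boundary_form by metis
    next
      case False
      then obtain r' where r': "e' = ereal r'" by auto
      obtain a' b' where "(M2 \<longlongrightarrow> a') E'" "(M1 \<longlongrightarrow> b') E'"
        using tame_limit[OF A.less E'] tame_M2 tame_M1 by blast
      note lim = boundary_form_limit_finite[OF E'[unfolded r'] this, of ?P ?Q]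
      define q :: "complex poly" where "q = [:- of_real r', 1:]"
      have "p = q * q" "poly q (of_real r') = 0"
        by (simp_all add: p_def r' q_def power2_eq_square)
      then have "poly (p * s) (of_real r') = 0" "poly (pderiv (p * s)) (of_real r') = 0"
        by (simp_all add: pderiv_mult)
      with lim show ?thesis by (simp add: pderiv_mat_mat eval_mat_mat del: poly_mult)
    qed
    moreover obtain L where "(boundary_form ?P ?Q \<longlongrightarrow> L) E" "(boundary_form ?P ?Q \<longlongrightarrow> L) E'" using limits by blast
    ultimately have "(boundary_form ?P ?Q \<longlongrightarrow> 0) E"
      using tendsto_unique[OF endpoint_neq_bot[OF A.less E']] by blast
    from tendsto_unique[OF endpoint_neq_bot[OF A.less E] boundary_form_limit_finite[OF E[unfolded r] ab] this]
    show ?thesis by (simp add: pderiv_mat_mat eval_mat_mat)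
  qed
  \<comment> \<open>\<open>s = x - r\<close> makes \<open>p s\<close> vanish at \<open>r\<close>
    with derivative \<open>p(r)\<close>, which isolates \<open>a\<close>; afterwards
    \<open>s = 1\<close> isolates \<open>b\<close>.\<close>
  obtain q :: "complex poly" where "poly q (of_real r) = 0" "pderiv q = 1"
    using that[of "[:- of_real r, 1:]"] by (simp add: pderiv_pCons one_pCons)
  then have "mat (poly p (of_real r)) ** a = 0"
    using *[of q] by (simp add: pderiv_mult)
  then have "a = 0" using invertible_0_right invertible_mat[OF p] by blast
  moreover have "mat (poly p (of_real r)) ** b = 0"
    using *[of 1] \<open>a = 0\<close> by simp
  then have "b = 0" using invertible_0_right invertible_mat[OF p] by blast
  ultimately show ?thesis using ab by simp
qed

text \<open>Adjointness makes the jump zero, so the limits of every boundary form at the two ends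
  coincide; exchanging the ends gives the conditions at both.\<close>

lemma boundary_conditions_if_adjoint_ops:
  assumes "adjoint_ops x0 x1 W Wt [:F0, F1, F2:] [:G0, G1, G2:]"
  shows "boundary_conditions x0 x1 W Wt F1 F2 G1"
proof -
  let ?L = "filtermap real_of_ereal (at_right x0)" and ?R = "filtermap real_of_ereal (at_left x1)"
  have end_L: "endpoint x0 x1 x0 ?L" and end_R: "endpoint x0 x1 x1 ?R" by (simp_all add: endpoint_def)
  have ends: "\<exists>L. (boundary_form P Q \<longlongrightarrow> L) ?L \<and> (boundary_form P Q \<longlongrightarrow> L) ?R"
    for P :: "complex poly^'n1^'n1" and Q :: "complex poly^'n2^'n2"
  proof -
    obtain a b where "(boundary_form P Q \<longlongrightarrow> a) ?L" "(boundary_form P Q \<longlongrightarrow> b) ?R"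
      using tame_limit[OF A.less end_L] tame_limit[OF A.less end_R] tame_boundary_form[of P Q] by metis
    moreover from ip_diff_eq_boundary[OF this] have "a = b" using assms by (simp add: adjoint_ops_def)
    ultimately show ?thesis by blast
  qed
  have "(M2 \<longlongrightarrow> 0) ?L \<and> (M1 \<longlongrightarrow> 0) ?L"
    using A.less by (intro boundary_limits_0[OF end_L end_R] ends) auto
  moreover have "(M2 \<longlongrightarrow> 0) ?R \<and> (M1 \<longlongrightarrow> 0) ?R"
    using A.less ends by (intro boundary_limits_0[OF end_R end_L]) (auto simp: conj_commute)
  ultimately show ?thesis unfolding boundary_conditions_iff by (auto simp: endpoint_def)
qed

end

subsection \<open>Direct sums of weights\<close>

definition left_cols :: "'a^('n::finite + 'm::finite)^'k \<Rightarrow> 'a^'n^'k" where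
  "left_cols P = (\<chi> i j. P $ i $ Inl j)"

definition right_cols :: "'a^('n::finite + 'm::finite)^'k \<Rightarrow> 'a^'m^'k" where
  "right_cols P = (\<chi> i j. P $ i $ Inr j)"

text \<open>Placing \<open>V\<close> and \<open>N\<close> off the diagonal yields square operators
  for the direct sum, the setting in which \<open>good_enough\<close> speaks of adjoints.\<close>

definition block12 :: "'a::zero^'m::finite^'n::finite \<Rightarrow> 'a^('n + 'm)^('n + 'm)" where
  "block12 F = (\<chi> i j. case i of Inl k \<Rightarrow> (case j of Inl l \<Rightarrow> 0 | Inr l \<Rightarrow> F $ k $ l) | Inr k \<Rightarrow> 0)"

definition block21 :: "'a::zero^'n::finite^'m::finite \<Rightarrow> 'a^('n + 'm)^('n + 'm)" where
  "block21 G = (\<chi> i j. case i of Inl k \<Rightarrow> 0 | Inr k \<Rightarrow> (case j of Inl l \<Rightarrow> G $ k $ l | Inr l \<Rightarrow> 0))"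

lemma sum_UNIV_sum_type:
  "(\<Sum>i\<in>UNIV. f i) = (\<Sum>i\<in>UNIV. f (Inl i)) + (\<Sum>i\<in>UNIV. f (Inr i))"
  for f :: "'n::finite + 'm::finite \<Rightarrow> 'a::comm_monoid_add"
  by (simp add: UNIV_Plus_UNIV[symmetric] sum.Plus o_def del: UNIV_Plus_UNIV)

lemma left_cols_block:
  "left_cols (P ** block12 F) = 0" "left_cols (P ** block21 G) = right_cols P ** G"
  "right_cols (P ** block12 F) = left_cols P ** F" "right_cols (P ** block21 G) = 0"
  by (simp_all add: left_cols_def right_cols_def block12_def block21_def matrix_matrix_mult_def
      vec_eq_iff sum_UNIV_sum_type)

lemma cols_add:
  "left_cols (P + Q) = left_cols P + left_cols Q" "right_cols (P + Q) = right_cols P + right_cols Q"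
  by (simp_all add: left_cols_def right_cols_def vec_eq_iff)

lemma cols_pderiv_mat:
  "left_cols (pderiv_mat P) = pderiv_mat (left_cols P)"
  "right_cols (pderiv_mat P) = pderiv_mat (right_cols P)"
  by (simp_all add: left_cols_def right_cols_def pderiv_mat_def vec_eq_iff)

lemma cols_eval_mat:
  "left_cols (eval_mat P x) = eval_mat (left_cols P) x"
  "right_cols (eval_mat P x) = eval_mat (right_cols P) x"
  by (simp_all add: left_cols_def right_cols_def eval_mat_def vec_eq_iff)

lemma cols_op_poly:
  "left_cols (op_poly P [:block12 F0, block12 F1, block12 F2:]) = 0"
  "right_cols (op_poly P [:block12 F0, block12 F1, block12 F2:]) = op_poly (left_cols P) [:F0, F1, F2:]"
  "left_cols (op_poly P [:block21 G0, block21 G1, block21 G2:]) = op_poly (right_cols P) [:G0, G1, G2:]"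
  "right_cols (op_poly P [:block21 G0, block21 G1, block21 G2:]) = 0"
  by (simp_all add: op_poly_quadratic cols_add left_cols_block cols_pderiv_mat)

text \<open>The off-diagonal blocks of the direct sum are zero, so its inner product is the sum of
  the inner products of the column blocks.\<close>

lemma direct_sum_sandwich:
  "X ** direct_sum A B ** hermitian_conj Y =
     left_cols X ** A ** hermitian_conj (left_cols Y) + right_cols X ** B ** hermitian_conj (right_cols Y)"
  by (simp add: left_cols_def right_cols_def direct_sum_def matrix_matrix_mult_def
      vec_eq_iff sum_UNIV_sum_type)

lemma direct_sum_mult: "direct_sum A B ** direct_sum A' B' = direct_sum (A ** A') (B ** B')"
  by (auto simp: direct_sum_def matrix_matrix_mult_def vec_eq_iff sum_UNIV_sum_type split: sum.split)

lemma direct_sum_1: "direct_sum (mat 1) (mat 1) = mat 1"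
  by (auto simp: direct_sum_def mat_def vec_eq_iff split: sum.split)

lemma invertible_direct_sum: "invertible A \<Longrightarrow> invertible B \<Longrightarrow> invertible (direct_sum A B)"
  unfolding invertible_def by (metis direct_sum_1 direct_sum_mult)

lemma direct_sum_mult_block21: "direct_sum A B ** block21 M = block21 (B ** M)"
  and block21_mult_direct_sum: "block21 M ** direct_sum A B = block21 (M ** A)"
  by (auto simp: direct_sum_def block21_def matrix_matrix_mult_def vec_eq_iff sum_UNIV_sum_type split: sum.split)

lemma hermitian_conj_block12: "hermitian_conj (block12 M) = block21 (hermitian_conj M)"
  by (auto simp: block12_def block21_def vec_eq_iff split: sum.split)

lemma eval_mat_block: "eval_mat (block12 F) x = block12 (eval_mat F x)"
  "eval_mat (block21 G) x = block21 (eval_mat G x)"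
  by (auto simp: block12_def block21_def eval_mat_def vec_eq_iff split: sum.split)

lemma bounded_linear_block21: "bounded_linear (block21 :: complex^'n^'m \<Rightarrow> _)"
  by (intro linear_conv_bounded_linear[THEN iffD1] linearI)
    (auto simp: block21_def vec_eq_iff split: sum.split)

lemma block21_add: "block21 (A + B) = block21 A + block21 B"
  and block21_diff: "block21 (A - B) = block21 A - block21 B"
  and block21_scaleR: "block21 (c *\<^sub>R A) = c *\<^sub>R block21 A" for A B :: "complex^'n^'m"
  by (auto simp: block21_def vec_eq_iff split: sum.split)

lemma block12_0 [simp]: "block12 0 = 0"
  by (auto simp: block12_def vec_eq_iff split: sum.split)

lemma block21_inject: "block21 A = block21 B \<longleftrightarrow> A = B"
proof
  assume "block21 A = block21 B"
  then have "block21 A $ Inr i $ Inl j = block21 B $ Inr i $ Inl j" for i j by simp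
  then show "A = B" by (simp add: block21_def vec_eq_iff)
qed simp

section \<open>From the formal adjoint to the symmetry equations\<close>

lemma adjoint_action_quadratic:
  "adjoint_action W [:D0, D1, D2:] Q x =
     (eval_mat Q x ** W x ** hermitian_conj (eval_mat D0 x)
      - nth_deriv (Suc 0) (\<lambda>t. eval_mat Q t ** W t ** hermitian_conj (eval_mat D1 t)) x
      + nth_deriv (Suc (Suc 0)) (\<lambda>t. eval_mat Q t ** W t ** hermitian_conj (eval_mat D2 t)) x)
     ** matrix_inv (W x)"
proof -
  let ?D = "[:D0, D1, D2:]"
  have zero: "nth_deriv j (\<lambda>t. 0 :: complex^'a^'a) = (\<lambda>t. 0)" for j
    by (induction j) (simp_all add: nth_deriv_Suc[abs_def])
  have "(\<Sum>j\<le>degree ?D. (- 1) ^ j *\<^sub>R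
        nth_deriv j (\<lambda>t. eval_mat Q t ** W t ** hermitian_conj (eval_mat (coeff ?D j) t)) x)
      = (\<Sum>j\<le>2. (- 1) ^ j *\<^sub>R
        nth_deriv j (\<lambda>t. eval_mat Q t ** W t ** hermitian_conj (eval_mat (coeff ?D j) t)) x)"
    by (rule sum.mono_neutral_left) (auto simp: coeff_eq_0 degree_pCons_eq_if numeral_2_eq_2 zero)
  then show ?thesis by (simp add: adjoint_action_def numeral_2_eq_2)
qed

text \<open>The images of \<open>1\<close>, \<open>x\<close> and \<open>x^2\<close> determine the
  coefficients in triangular fashion.\<close>

lemma eval_mat_op_poly_monomials:
  fixes G0 G1 G2 :: "complex poly^'n^'m"
  shows "eval_mat (op_poly (mat 1) [:G0, G1, G2:]) x = eval_mat G0 x"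
    and "eval_mat (op_poly (mat_shift (mat 1)) [:G0, G1, G2:]) x = x *\<^sub>R eval_mat G0 x + eval_mat G1 x"
    and "eval_mat (op_poly (mat_shift (mat_shift (mat 1))) [:G0, G1, G2:]) x =
      x *\<^sub>R x *\<^sub>R eval_mat G0 x + 2 *\<^sub>R x *\<^sub>R eval_mat G1 x + 2 *\<^sub>R eval_mat G2 x"
  by (simp_all only: op_poly_quadratic pderiv_mat_shift pderiv_mat_add pderiv_mat_1 mat_shift_0
      pderiv_mat_0 add_0_left add_0_right mat_shift_mult_left matrix_add_rdistrib matrix_mul_lid times0_left
      eval_mat_add eval_mat_shift eval_mat_0 scaleR_2 scaleR_add_right)

context weight_pair begin

text \<open>Each block operator has values in one column block only, so a single pairing remains on
  each side: that of the left columns of \<open>P\<close> under \<open>V\<close> with the right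
  columns of \<open>Q\<close>.\<close>

lemma direct_sum_adjoint:
  fixes F0 F1 F2 :: "complex poly^'n2^'n1" and G0 G1 G2 :: "complex poly^'n1^'n2"
    and P Q :: "complex poly^('n1 + 'n2)^('n1 + 'n2)"
  assumes "adjoint_ops x0 x1 W Wt [:F0, F1, F2:] [:G0, G1, G2:]"
  shows "weight_inner x0 x1 (\<lambda>x. direct_sum (W x) (Wt x))
      (op_poly P [:block12 F0, block12 F1, block12 F2:]) Q =
    weight_inner x0 x1 (\<lambda>x. direct_sum (W x) (Wt x))
      P (op_poly Q [:block21 G0, block21 G1, block21 G2:])"
  using adjoint_ops_arbitrary_rows[OF assms, of "left_cols P" "right_cols Q"]
  by (simp add: weight_inner_def direct_sum_sandwich cols_eval_mat cols_op_poly)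

text \<open>The formal adjoint is compared with \<open>N\<close> at the test polynomial
  \<open>x^k I\<close>. Only the lower left block is nonzero, and positive definiteness at
  \<open>x\<close> lets the inverse in \<open>adjoint_action\<close> cancel.\<close>

lemma symmetry_equation_monomial:
  fixes F0 F1 F2 :: "complex poly^'n2^'n1" and G0 G1 G2 :: "complex poly^'n1^'n2"
    and Q :: "complex poly^('n1 + 'n2)^('n1 + 'n2)"
  assumes "adjoint_ops x0 x1 W Wt [:F0, F1, F2:] [:G0, G1, G2:]"
    and good: "good_enough x0 x1 (\<lambda>x. direct_sum (W x) (Wt x))"
    and x: "x \<in> A.I" "positive_definite (W x)" "positive_definite (Wt x)"
    and Z: "eval_mat (op_poly ((mat_shift ^^ k) (mat 1)) [:block21 G0, block21 G1, block21 G2:]) x = block21 Z"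
  shows "Z ** W x = B.weighted ((mat_shift ^^ k) F0) x
      - nth_deriv (Suc 0) (B.weighted ((mat_shift ^^ k) F1)) x
      + nth_deriv (Suc (Suc 0)) (B.weighted ((mat_shift ^^ k) F2)) x"
proof -
  let ?Q = "(mat_shift ^^ k) (mat 1) :: complex poly^('n1 + 'n2)^('n1 + 'n2)"
  let ?S = "\<lambda>x. direct_sum (W x) (Wt x)"
  have inv: "invertible (?S x)"
    by (intro invertible_direct_sum positive_definite_invertible x)
  have "\<forall>Q. \<forall>x\<in>A.I. invertible (?S x) \<longrightarrow>
      eval_mat (op_poly Q [:block21 G0, block21 G1, block21 G2:]) x =
      adjoint_action ?S [:block12 F0, block12 F1, block12 F2:] Q x"
    using good direct_sum_adjoint[OF assms(1)] unfolding good_enough_def by blast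
  then have "block21 Z = adjoint_action ?S [:block12 F0, block12 F1, block12 F2:] ?Q x"
    using x inv by (simp add: Z[symmetric])
  then have "block21 Z ** ?S x = eval_mat ?Q x ** ?S x ** hermitian_conj (eval_mat (block12 F0) x)
      - nth_deriv (Suc 0) (\<lambda>t. eval_mat ?Q t ** ?S t ** hermitian_conj (eval_mat (block12 F1) t)) x
      + nth_deriv (Suc (Suc 0)) (\<lambda>t. eval_mat ?Q t ** ?S t ** hermitian_conj (eval_mat (block12 F2) t)) x"
    by (simp add: adjoint_action_quadratic matrix_inv_left[OF inv] flip: matrix_mul_assoc)
  also have "\<dots> = block21 (B.weighted ((mat_shift ^^ k) F0) x
      - nth_deriv (Suc 0) (B.weighted ((mat_shift ^^ k) F1)) x
      + nth_deriv (Suc (Suc 0)) (B.weighted ((mat_shift ^^ k) F2)) x)"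
  proof -
    \<comment> \<open>The real scalar \<open>t^k\<close> moves onto \<open>F\<close>, and
      conjugation turns the upper right block into a lower left one, which meets only
      \<open>Wt\<close>.\<close>
    have f: "(\<lambda>t. eval_mat ?Q t ** ?S t ** hermitian_conj (eval_mat (block12 F) t)) =
        (\<lambda>t. block21 (B.weighted ((mat_shift ^^ k) F) t))" for F :: "complex poly^'n2^'n1"
      by (simp add: fun_eq_iff eval_mat_funpow_shift matrix_distribs eval_mat_block hermitian_conj_block12
          direct_sum_mult_block21 B.weighted_def hermitian_conj_scaleR block21_scaleR)
    have d1: "((\<lambda>t. block21 (B.weighted F t)) has_vector_derivative
        block21 (nth_deriv (Suc 0) (B.weighted F) t)) (at t)" if "t \<in> A.I" for t and F :: "complex poly^'n2^'n1"
      by (rule bounded_linear.has_vector_derivative[OF bounded_linear_block21 B.nth_deriv_weighted(2)[OF that]])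
    have d2: "(nth_deriv (Suc 0) (\<lambda>t. block21 (B.weighted F t)) has_vector_derivative
        block21 (nth_deriv (Suc (Suc 0)) (B.weighted F) x)) (at x)" for F :: "complex poly^'n2^'n1"
      by (rule has_vector_derivative_nth_deriv[OF open_einterval x(1) d1])
        (assumption, rule bounded_linear.has_vector_derivative[OF bounded_linear_block21
            B.nth_deriv_weighted(4)[OF x(1)]])
    have "nth_deriv (Suc (Suc 0)) (\<lambda>t. block21 (B.weighted F t)) x =
        block21 (nth_deriv (Suc (Suc 0)) (B.weighted F) x)" for F :: "complex poly^'n2^'n1"
      using vector_derivative_at[OF d2[of F]]
      by (simp only: nth_deriv_Suc[of "Suc 0" "\<lambda>t. block21 (B.weighted F t)"])
    then show ?thesis
      using fun_cong[OF f[of F0], of x]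
      by (simp only: f nth_deriv_Suc_0I[OF d1[OF x(1)]] block21_add block21_diff)
  qed
  finally show ?thesis
    by (simp only: block21_mult_direct_sum block21_inject)
qed

text \<open>The test polynomials \<open>1\<close>, \<open>x\<close>, \<open>x^2\<close> give a
  triangular system equivalent to the symmetry equations wherever both weights are positive
  definite; continuity covers the remaining points.\<close>

lemma symmetry_equations_if_adjoint_ops:
  fixes F0 F1 F2 :: "complex poly^'n2^'n1" and G0 G1 G2 :: "complex poly^'n1^'n2"
  assumes adj: "adjoint_ops x0 x1 W Wt [:F0, F1, F2:] [:G0, G1, G2:]"
    and good: "good_enough x0 x1 (\<lambda>x. direct_sum (W x) (Wt x))"
  shows "symmetry_equations x0 x1 W Wt F0 F1 F2 G0 G1 G2"
proof -
  let ?d1 = "\<lambda>F. nth_deriv (Suc 0) (B.weighted F)"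
  let ?d2 = "\<lambda>F. nth_deriv (Suc (Suc 0)) (B.weighted F)"
  have eqs: "eval_mat G2 x ** W x = B.weighted F2 x
      \<and> eval_mat G1 x ** W x = 2 *\<^sub>R ?d1 F2 x - B.weighted F1 x
      \<and> eval_mat G0 x ** W x = ?d2 F2 x - ?d1 F1 x + B.weighted F0 x"
    if x: "x \<in> A.I" "positive_definite (W x)" "positive_definite (Wt x)" for x
  proof -
    note eq = symmetry_equation_monomial[OF adj good x]
    have 0: "eval_mat G0 x ** W x = B.weighted F0 x - ?d1 F1 x + ?d2 F2 x"
      using eq[of 0 "eval_mat G0 x"] by (simp add: eval_mat_op_poly_monomials eval_mat_block)
    have "(x *\<^sub>R eval_mat G0 x + eval_mat G1 x) ** W x =
        B.weighted (mat_shift F0) x - ?d1 (mat_shift F1) x + ?d2 (mat_shift F2) x"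
      using eq[of 1 "x *\<^sub>R eval_mat G0 x + eval_mat G1 x"]
      by (simp add: eval_mat_op_poly_monomials eval_mat_block block21_add block21_scaleR)
    then have 1: "x *\<^sub>R (eval_mat G0 x ** W x) + eval_mat G1 x ** W x = x *\<^sub>R B.weighted F0 x
        - (B.weighted F1 x + x *\<^sub>R ?d1 F1 x) + (2 *\<^sub>R ?d1 F2 x + x *\<^sub>R ?d2 F2 x)"
      by (simp only: matrix_distribs B.weighted_shift B.nth_deriv_weighted_shift[OF x(1)])
    have "(x *\<^sub>R x *\<^sub>R eval_mat G0 x + 2 *\<^sub>R x *\<^sub>R eval_mat G1 x + 2 *\<^sub>R eval_mat G2 x) ** W x
        = B.weighted (mat_shift (mat_shift F0)) x - ?d1 (mat_shift (mat_shift F1)) x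
          + ?d2 (mat_shift (mat_shift F2)) x"
      using eq[of "Suc (Suc 0)"
          "x *\<^sub>R x *\<^sub>R eval_mat G0 x + 2 *\<^sub>R x *\<^sub>R eval_mat G1 x + 2 *\<^sub>R eval_mat G2 x"]
      by (simp only: funpow.simps o_apply id_apply eval_mat_op_poly_monomials eval_mat_block
          block21_add block21_scaleR)
    then have 2: "x *\<^sub>R x *\<^sub>R (eval_mat G0 x ** W x) + 2 *\<^sub>R x *\<^sub>R (eval_mat G1 x ** W x)
          + 2 *\<^sub>R (eval_mat G2 x ** W x)
        = x *\<^sub>R x *\<^sub>R B.weighted F0 x
          - (x *\<^sub>R B.weighted F1 x + x *\<^sub>R (B.weighted F1 x + x *\<^sub>R ?d1 F1 x))
          + (2 *\<^sub>R (B.weighted F2 x + x *\<^sub>R ?d1 F2 x) + x *\<^sub>R (2 *\<^sub>R ?d1 F2 x + x *\<^sub>R ?d2 F2 x))"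
      by (simp only: matrix_distribs B.weighted_shift B.nth_deriv_weighted_shift[OF x(1)])
    \<comment> \<open>Elimination is done entrywise over the scalars: the first relation removes
      \<open>a\<close> from the second, and both reduce the third to \<open>c\<close>.\<close>
    have solve: "c = y2 \<and> b = 2 * y2' - y1 \<and> a = y2'' - y1' + y0"
      if "a = y0 - y1' + y2''" "z * a + b = z * y0 - (y1 + z * y1') + (2 * y2' + z * y2'')"
        "z * (z * a) + 2 * (z * b) + 2 * c = z * (z * y0) - (z * y1 + z * (y1 + z * y1'))
          + (2 * (y2 + z * y2') + z * (2 * y2' + z * y2''))"
      for a b c y0 y1 y1' y2 y2' y2'' z :: complex
    proof -
      have b: "b = 2 * y2' - y1" using that(2) unfolding that(1) by (simp add: algebra_simps)
      have "2 * c = 2 * y2" using that(3) unfolding that(1) b by (simp add: algebra_simps)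
      then show ?thesis using b that(1) by simp
    qed
    note entries = vec_eq_iff vector_add_component vector_minus_component vector_scaleR_component
        scaleR_conv_of_real[where 'a = complex] of_real_numeral
    note solved = solve[OF 0[unfolded entries, rule_format] 1[unfolded entries, rule_format]
        2[unfolded entries, rule_format]]
    show ?thesis unfolding entries using solved by blast
  qed
  have AE: "AE x in lborel. x \<in> A.I \<longrightarrow> eval_mat G2 x ** W x = B.weighted F2 x
      \<and> eval_mat G1 x ** W x = 2 *\<^sub>R ?d1 F2 x - B.weighted F1 x
      \<and> eval_mat G0 x ** W x = ?d2 F2 x - ?d1 F1 x + B.weighted F0 x"
    using A.AE_positive_definite B.AE_positive_definite by eventually_elim (use eqs in blast)
  have contG: "continuous_on A.I (\<lambda>x. eval_mat G x ** W x)" for G :: "complex poly^'n1^'n2"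
    using A.continuous_on_weight[of 0] by (auto intro!: continuous_intros)
  have "eval_mat G2 x ** W x = B.weighted F2 x
      \<and> eval_mat G1 x ** W x = 2 *\<^sub>R ?d1 F2 x - B.weighted F1 x
      \<and> eval_mat G0 x ** W x = ?d2 F2 x - ?d1 F1 x + B.weighted F0 x" if "x \<in> A.I" for x
    by (intro conjI; rule continuous_AE_eq_imp_eq[OF open_einterval contG _ _ that])
      (use AE in \<open>auto elim!: eventually_mono intro!: continuous_intros B.continuous_on_weighted\<close>)
  then show ?thesis
    by (simp add: symmetry_equations_def Let_def B.weighted_def[abs_def] numeral_2_eq_2)
qed

end

theorem theorem3p11:
  fixes x0 x1 :: ereal
    and W :: "real \<Rightarrow> complex^'n1^'n1"
    and Wt :: "real \<Rightarrow> complex^'n2^'n2"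
    and F0 F1 F2 :: "complex poly^'n2^'n1"
  assumes "x0 < x1"
    and "weight_matrix x0 x1 W"
    and "weight_matrix x0 x1 Wt"
    and "good_enough x0 x1 W"
    and "good_enough x0 x1 Wt"
    and "good_enough x0 x1 (\<lambda>x. direct_sum (W x) (Wt x))"
    and "mat_degree_le F0 0" and "mat_degree_le F1 1" and "mat_degree_le F2 2"
  shows "([:F0, F1, F2:] \<in> op_module x0 x1 W Wt \<longleftrightarrow>
           (\<exists>(G0 :: complex poly^'n1^'n2) (G1 :: complex poly^'n1^'n2) (G2 :: complex poly^'n1^'n2).
              mat_degree_le G0 0 \<and> mat_degree_le G1 1 \<and> mat_degree_le G2 2 \<and>
              symmetry_equations x0 x1 W Wt F0 F1 F2 G0 G1 G2 \<and>
              boundary_conditions x0 x1 W Wt F1 F2 G1)) \<and>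
         (\<forall>(G0 :: complex poly^'n1^'n2) (G1 :: complex poly^'n1^'n2) (G2 :: complex poly^'n1^'n2).
            mat_degree_le G0 0 \<and> mat_degree_le G1 1 \<and> mat_degree_le G2 2 \<and>
            symmetry_equations x0 x1 W Wt F0 F1 F2 G0 G1 G2 \<and>
            boundary_conditions x0 x1 W Wt F1 F2 G1 \<longrightarrow>
            [:G0, G1, G2:] \<in> op_module x0 x1 Wt W)"
proof -
  interpret pair: weight_pair x0 x1 W Wt
    by (intro weight_pair.intro weight.intro assms)
  \<comment> \<open>\<open>N\<close> has \<open>V\<close> as its adjoint, so the criterion for
    membership applies to \<open>N\<close> with the weights exchanged.\<close>
  interpret swapped: weight_pair x0 x1 Wt W
    by (intro weight_pair.intro weight.intro assms)
  have symmetric: "symmetric_pair x0 x1 W Wt F0 F1 F2 G0 G1 G2"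
    if "symmetry_equations x0 x1 W Wt F0 F1 F2 G0 G1 G2" for G0 G1 G2 :: "complex poly^'n1^'n2"
    using that by (simp add: symmetric_pair_def symmetric_pair_axioms_def pair.weight_pair_axioms)
  have adjoint: "adjoint_ops x0 x1 W Wt [:F0, F1, F2:] [:G0, G1, G2:]"
    if "symmetry_equations x0 x1 W Wt F0 F1 F2 G0 G1 G2" "boundary_conditions x0 x1 W Wt F1 F2 G1"
    for G0 G1 G2 :: "complex poly^'n1^'n2"
    using symmetric_pair.adjoint_ops_if_boundary_conditions[OF symmetric] that by blast
  show ?thesis
  proof (intro conjI iffI allI impI; (elim exE conjE)?)
    assume "[:F0, F1, F2:] \<in> op_module x0 x1 W Wt"
    then obtain G0 G1 G2 :: "complex poly^'n1^'n2" where G: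
      "mat_degree_le G0 0" "mat_degree_le G1 1" "mat_degree_le G2 2"
      "adjoint_ops x0 x1 W Wt [:F0, F1, F2:] [:G0, G1, G2:]"
      using pair.adjoint_exists by blast
    moreover have sym: "symmetry_equations x0 x1 W Wt F0 F1 F2 G0 G1 G2"
      by (rule pair.symmetry_equations_if_adjoint_ops) fact+
    moreover have "boundary_conditions x0 x1 W Wt F1 F2 G1"
      by (rule symmetric_pair.boundary_conditions_if_adjoint_ops[OF symmetric[OF sym] G(4)])
    ultimately show "\<exists>(G0 :: complex poly^'n1^'n2) (G1 :: complex poly^'n1^'n2) (G2 :: complex poly^'n1^'n2).
        mat_degree_le G0 0 \<and> mat_degree_le G1 1 \<and> mat_degree_le G2 2 \<and>
        symmetry_equations x0 x1 W Wt F0 F1 F2 G0 G1 G2 \<and> boundary_conditions x0 x1 W Wt F1 F2 G1"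
      by blast
  next
    fix G0 G1 G2 :: "complex poly^'n1^'n2"
    assume "mat_degree_le G0 0" "mat_degree_le G1 1" "mat_degree_le G2 2"
      "symmetry_equations x0 x1 W Wt F0 F1 F2 G0 G1 G2" "boundary_conditions x0 x1 W Wt F1 F2 G1"
    then show "[:F0, F1, F2:] \<in> op_module x0 x1 W Wt"
      using pair.op_module_if_adjoint[OF adjoint] assms(7-9) by blast
  next
    fix G0 G1 G2 :: "complex poly^'n1^'n2"
    assume "mat_degree_le G0 0" "mat_degree_le G1 1" "mat_degree_le G2 2"
      "symmetry_equations x0 x1 W Wt F0 F1 F2 G0 G1 G2" "boundary_conditions x0 x1 W Wt F1 F2 G1"
    then show "[:G0, G1, G2:] \<in> op_module x0 x1 Wt W"
      using swapped.op_module_if_adjoint[OF pair.adjoint_ops_swap[OF adjoint]] assms(7-9) by blast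
  qed
qed

end
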